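(* Let $H\in(1/2,1)$, let $(B^H_t)_{t\ge 0}$ be a fractional Brownian motion with Hurst parameter $H$ on a complete probability space $(\Omega,\mathcal{F},P)$, and let $x_0>0$. Let $f$ satisfy assumptions (i), (ii) and (iii) stated in the context. Then there is a unique pathwise solution $X=(X_t,t\ge 0)$ to the equation $$X_t=x_0+\int_0^t f(s,X_s)\,ds+B^H_t,\qquad t\ge 0,$$ such that $X_t>0$ almost surely on $[0,\infty)$; and for any $T>0$, $\|X\|_{0,T,\infty}\in L^p(\Omega)$ for all $p>0$.
   Context: A fractional Brownian motion with Hurst parameter $H$ is a mean zero Gaussian process $(B^H_t)_{t\ge0}$ with covariance $\mathbb{E}(B^H_tB^H_s)=\frac12\left(t^{2H}+s^{2H}-|t-s|^{2H}\right)$; it is taken with continuous paths. For a continuous function $x$ on $[0,T]$, $\|x\|_{0,T,\infty}=\sup\{|x(r)|:0\le r\le T\}$. A pathwise solution is a process with continuous paths satisfying the equation path by path; positivity and uniqueness hold for almost every path. Assumptions on $f$: (i) $f:[0,\infty)\times(0,\infty)\to[0,\infty)$ is a nonnegative continuous function which has a continuous partial derivative with respect to $x$ such that $\partial_x f(t,x)\le 0$ for all $t>0$, $x>0$. (ii) There exist $x_1>0$ and $\alpha>\frac1H-1$ such that $f(t,x)\ge g(t)x^{-\alpha}$ for all $t\ge0$ and $x\in(0,x_1)$, where $g$ is a nonnegative continuous function on $[0,\infty)$ with $g(t)>0$ for all $t>0$. (iii) $f(t,x)\le h(t)\left(1+\frac1x\right)$ for all $t\ge0$ and $x>0$, where $h$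 is a nonnegative locally bounded function on $[0,\infty)$. *)

theory Defs
  imports "HOL-Probability.Probability"
begin

(* Dirac laws count as Gaussian: B 0 and the zero linear combination have variance 0. *)
definition gaussian_rv :: "'w measure \<Rightarrow> ('w \<Rightarrow> real) \<Rightarrow> bool" where
  "gaussian_rv M Z \<longleftrightarrow> Z \<in> borel_measurable M \<and>
     ((\<exists>\<mu> \<sigma>. 0 < \<sigma> \<and> distributed M lborel Z (normal_density \<mu> \<sigma>)) \<or>
      (\<exists>\<mu>. AE \<omega> in M. Z \<omega> = \<mu>))"

definition gaussian_process :: "'w measure \<Rightarrow> (real \<Rightarrow> 'w \<Rightarrow> real) \<Rightarrow> bool" where
  "gaussian_process M B \<longleftrightarrow>
     (\<forall>I c. finite I \<and> I \<subseteq> {0..} \<longrightarrow> gaussian_rv M (\<lambda>\<omega>. \<Sum>t\<in>I. c t * B t \<omega>))"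

(* Processes are indexed by all of real; only their values at times t >= 0 matter. *)
definition continuous_paths :: "'w measure \<Rightarrow> (real \<Rightarrow> 'w \<Rightarrow> real) \<Rightarrow> bool" where
  "continuous_paths M X \<longleftrightarrow> (\<forall>\<omega>\<in>space M. continuous_on {0..} (\<lambda>t. X t \<omega>))"

definition fractional_brownian_motion ::
    "'w measure \<Rightarrow> real \<Rightarrow> (real \<Rightarrow> 'w \<Rightarrow> real) \<Rightarrow> bool" where
  "fractional_brownian_motion M H B \<longleftrightarrow>
     gaussian_process M B \<and>
     (\<forall>t\<ge>0. integral\<^sup>L M (B t) = 0) \<and>
     (\<forall>t\<ge>0. \<forall>s\<ge>0. integral\<^sup>L M (\<lambda>\<omega>. B t \<omega> * B s \<omega>) =
        (t powr (2 * H) + s powr (2 * H) - \<bar>t - s\<bar> powr (2 * H)) / 2) \<and>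
     continuous_paths M B"

(* The drift f t x is a total function here, but every condition below, and the equation
   along a positive path, involves it only for t >= 0 and x > 0. *)
definition assumption_i :: "(real \<Rightarrow> real \<Rightarrow> real) \<Rightarrow> bool" where
  "assumption_i f \<longleftrightarrow>
     (\<forall>t\<ge>0. \<forall>x>0. 0 \<le> f t x) \<and>
     continuous_on ({0..} \<times> {0<..}) (\<lambda>(t, x). f t x) \<and>
     (\<forall>t\<ge>0. \<forall>x>0. f t field_differentiable (at x)) \<and>
     continuous_on ({0..} \<times> {0<..}) (\<lambda>(t, x). deriv (f t) x) \<and>
     (\<forall>t>0. \<forall>x>0. deriv (f t) x \<le> 0)"

definition assumption_ii :: "real \<Rightarrow> (real \<Rightarrow> real \<Rightarrow> real) \<Rightarrow> bool" where
  "assumption_ii H f \<longleftrightarrow>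
     (\<exists>x1>0. \<exists>\<alpha>>1 / H - 1. \<exists>g :: real \<Rightarrow> real.
        continuous_on {0..} g \<and> (\<forall>t\<ge>0. 0 \<le> g t) \<and> (\<forall>t>0. 0 < g t) \<and>
        (\<forall>t\<ge>0. \<forall>x\<in>{0<..<x1}. g t * x powr (- \<alpha>) \<le> f t x))"

definition assumption_iii :: "(real \<Rightarrow> real \<Rightarrow> real) \<Rightarrow> bool" where
  "assumption_iii f \<longleftrightarrow>
     (\<exists>h :: real \<Rightarrow> real.
        (\<forall>t\<ge>0. 0 \<le> h t) \<and> (\<forall>T\<ge>0. bounded (h ` {0..T})) \<and>
        (\<forall>t\<ge>0. \<forall>x>0. f t x \<le> h t * (1 + 1 / x)))"

(* The equation is required for almost every path only: B 0 = 0 holds just almost surely. *)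
definition pathwise_solution ::
    "'w measure \<Rightarrow> (real \<Rightarrow> real \<Rightarrow> real) \<Rightarrow> real \<Rightarrow> (real \<Rightarrow> 'w \<Rightarrow> real) \<Rightarrow> (real \<Rightarrow> 'w \<Rightarrow> real) \<Rightarrow> bool" where
  "pathwise_solution M f x0 B X \<longleftrightarrow>
     (\<forall>t\<ge>0. X t \<in> borel_measurable M) \<and>
     continuous_paths M X \<and>
     (AE \<omega> in M. \<forall>t\<ge>0.
        (\<lambda>s. f s (X s \<omega>)) integrable_on {0..t} \<and>
        X t \<omega> = x0 + integral {0..t} (\<lambda>s. f s (X s \<omega>)) + B t \<omega>)"

definition positive_paths :: "'w measure \<Rightarrow> (real \<Rightarrow> 'w \<Rightarrow> real) \<Rightarrow> bool" where
  "positive_paths M X \<longleftrightarrow> (AE \<omega> in M. \<forall>t\<ge>0. 0 < X t \<omega>)"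

definition sup_norm :: "real \<Rightarrow> (real \<Rightarrow> real) \<Rightarrow> real" where
  "sup_norm T x = (SUP r\<in>{0..T}. \<bar>x r\<bar>)"

definition in_Lp :: "'w measure \<Rightarrow> real \<Rightarrow> ('w \<Rightarrow> real) \<Rightarrow> bool" where
  "in_Lp M p Z \<longleftrightarrow> Z \<in> borel_measurable M \<and> integrable M (\<lambda>\<omega>. \<bar>Z \<omega>\<bar> powr p)"

end

theory Submission
  imports Defs "HOL-Real_Asymp.Real_Asymp"
begin

text \<open>
  Fix \<open>\<beta> < H\<close> with \<open>\<beta> (\<alpha> + 1) > 1\<close>. By the Kolmogorov--Chentsov argument almost every path of \<open>B\<close> is
  \<open>\<beta>\<close>-Hoelder on compact intervals, with a Hoelder constant in every \<open>L\<^sup>p\<close>. If a solution first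
  reaches a small level \<open>\<delta> = C r\<^sup>\<beta>\<close> at time \<open>t\<^sub>0\<close>, then it stays below \<open>2 \<delta>\<close> on \<open>[t\<^sub>0 - r, t\<^sub>0]\<close>, so the
  singular drift pushes it up by at least a constant times \<open>r \<delta>\<^sup>-\<^sup>\<alpha>\<close>; the Hoelder bound leaves room for
  at most \<open>\<delta>\<close>, which is impossible for small \<open>r\<close>. This lower bound is uniform over the equations whose
  drift is clamped to \<open>[1/n, n]\<close> in the space variable. Those are Lipschitz, hence solved by Picard
  iteration, measurably in the path, and on each compact interval their solutions eventually stop
  depending on \<open>n\<close>. Uniqueness follows from monotonicity of the drift. Since the drift is bounded
  above \<open>x\<^sub>0\<close>, looking back to the last time below \<open>x\<^sub>0\<close> bounds the solution linearly by the oscillation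
  of \<open>B\<close>, which gives the moments.
\<close>

section \<open>Integral equations with monotone and singular drift\<close>

text \<open>The times at which \<open>w\<close> is at most \<open>c\<close> form a compact set, and
  its maximum is the required \<open>s\<close>; the intermediate value theorem excludes
  \<open>w s < c\<close>. The comparison arguments integrate only over the stretch after
  \<open>s\<close>.\<close>

lemma last_time_below:
  fixes w :: "real \<Rightarrow> real"
  assumes "continuous_on {a..b} w" "a \<le> b" "w a \<le> c" "c < w b"
  obtains s where "a \<le> s" "s < b" "w s = c" "\<And>r. s < r \<Longrightarrow> r \<le> b \<Longrightarrow> c < w r"
proof -
  define A where "A = {a..b} \<inter> w -` {..c}"
  have "closed A"
    unfolding A_def by (rule continuous_closed_preimage[OF assms(1)]) auto
  moreover have "bounded A"
    unfolding A_def by (rule bounded_subset[of "{a..b}"]) auto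
  ultimately have "compact A" by (simp add: compact_eq_bounded_closed)
  moreover have "A \<noteq> {}" using assms unfolding A_def by auto
  ultimately obtain s where s: "s \<in> A" "\<And>r. r \<in> A \<Longrightarrow> r \<le> s"
    using compact_attains_sup[of A] by blast
  have sb: "a \<le> s" "s \<le> b" "w s \<le> c" using s(1) by (auto simp: A_def)
  with assms(4) have "s < b" by (cases "s = b") auto
  have gt: "c < w r" if "s < r" "r \<le> b" for r
  proof (rule ccontr)
    assume "\<not> c < w r"
    with that sb have "r \<in> A" by (auto simp: A_def)
    with s(2) that show False by force
  qed
  have "w s = c"
  proof -
    have "continuous_on {s..b} w" using assms(1) by (rule continuous_on_subset) (use sb in auto)
    with sb assms(4) obtain x where x: "s \<le> x" "x \<le> b" "w x = c"
      using IVT'[of w s c b] by auto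
    with gt[of x] show ?thesis by (cases "x = s") auto
  qed
  with that sb \<open>s < b\<close> gt show ?thesis by blast
qed

text \<open>Time reversal of \<open>last_time_below\<close>.\<close>

lemma first_hitting_time:
  fixes w :: "real \<Rightarrow> real"
  assumes "continuous_on {a..b} w" "a \<le> b" "c < w a" "w b \<le> c"
  obtains s where "a < s" "s \<le> b" "w s = c" "\<And>r. a \<le> r \<Longrightarrow> r < s \<Longrightarrow> c < w r"
proof -
  have "continuous_on {-b..-a} (\<lambda>t. w (-t))"
    by (rule continuous_on_compose2[OF assms(1)]) (auto intro!: continuous_intros)
  then obtain s where s: "-b \<le> s" "s < -a" "w (-s) = c"
      "\<And>r. s < r \<Longrightarrow> r \<le> -a \<Longrightarrow> c < w (-r)"
    using last_time_below[of "-b" "-a" "\<lambda>t. w (-t)" c] assms by auto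
  show ?thesis
  proof (rule that[of "-s"])
    show "c < w r" if "a \<le> r" "r < -s" for r using s(4)[of "-r"] that by auto
  qed (use s in auto)
qed

lemma increment_integral_equation:
  fixes \<rho> \<phi> y :: "real \<Rightarrow> real"
  assumes "\<rho> integrable_on {0..T}"
    and "\<And>t. t \<in> {0..T} \<Longrightarrow> y t = x0 + integral {0..t} \<rho> + \<phi> t"
    and "0 \<le> s" "s \<le> t" "t \<le> T"
  shows "y t - y s = integral {s..t} \<rho> + (\<phi> t - \<phi> s)"
proof -
  have "\<rho> integrable_on {0..t}"
    using assms(1) by (rule integrable_on_subinterval) (use assms in auto)
  then have "integral {0..s} \<rho> + integral {s..t} \<rho> = integral {0..t} \<rho>"
    by (intro Henstock_Kurzweil_Integration.integral_combine) (use assms in auto)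
  then show ?thesis using assms(2)[of t] assms(2)[of s] assms(3-5) by auto
qed

text \<open>After the last time at which two solutions agree, the larger one has the smaller drift.
  The forcing terms cancel in the difference, so the gap can never open.\<close>

lemma monotone_drift_unique:
  fixes u v \<phi> :: "real \<Rightarrow> real"
  assumes anti: "\<And>s x y. 0 < s \<Longrightarrow> x \<in> S \<Longrightarrow> y \<in> S \<Longrightarrow> x \<le> y \<Longrightarrow> G s y \<le> G s x"
    and u: "continuous_on {0..T} u" "\<And>t. t \<in> {0..T} \<Longrightarrow> u t \<in> S"
    and v: "continuous_on {0..T} v" "\<And>t. t \<in> {0..T} \<Longrightarrow> v t \<in> S"
    and iu: "(\<lambda>s. G s (u s)) integrable_on {0..T}"
    and iv: "(\<lambda>s. G s (v s)) integrable_on {0..T}"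
    and eu: "\<And>t. t \<in> {0..T} \<Longrightarrow> u t = c + integral {0..t} (\<lambda>s. G s (u s)) + \<phi> t"
    and ev: "\<And>t. t \<in> {0..T} \<Longrightarrow> v t = c + integral {0..t} (\<lambda>s. G s (v s)) + \<phi> t"
    and t: "t \<in> {0..T}"
  shows "u t = v t"
proof -
  \<comment> \<open>Stated for arbitrary \<open>u\<close> and \<open>v\<close>, so that exchanging
    their roles gives the other inequality.\<close>
  have le: "u t \<le> v t"
    if u: "continuous_on {0..T} u" "\<And>t. t \<in> {0..T} \<Longrightarrow> u t \<in> S"
    and v: "continuous_on {0..T} v" "\<And>t. t \<in> {0..T} \<Longrightarrow> v t \<in> S"
    and iu: "(\<lambda>s. G s (u s)) integrable_on {0..T}"
    and iv: "(\<lambda>s. G s (v s)) integrable_on {0..T}"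
    and eu: "\<And>t. t \<in> {0..T} \<Longrightarrow> u t = c + integral {0..t} (\<lambda>s. G s (u s)) + \<phi> t"
    and ev: "\<And>t. t \<in> {0..T} \<Longrightarrow> v t = c + integral {0..t} (\<lambda>s. G s (v s)) + \<phi> t"
  for u v
  proof (rule ccontr)
    assume gt: "\<not> u t \<le> v t"
    have "continuous_on {0..t} (\<lambda>t. u t - v t)"
      by (intro continuous_on_diff continuous_on_subset[OF u(1)] continuous_on_subset[OF v(1)])
        (use t in auto)
    moreover have "u 0 - v 0 \<le> 0" using eu[of 0] ev[of 0] t by auto
    ultimately obtain s where s: "0 \<le> s" "s < t" "u s - v s = 0"
        "\<And>r. s < r \<Longrightarrow> r \<le> t \<Longrightarrow> 0 < u r - v r"
      using last_time_below[of 0 t "\<lambda>t. u t - v t" 0] gt t by auto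
    have sub: "{s..t} \<subseteq> {0..T}" using s t by auto
    have "integral {s..t} (\<lambda>r. G r (u r)) \<le> integral {s..t} (\<lambda>r. G r (v r))"
    proof (rule integral_le)
      show "(\<lambda>r. G r (u r)) integrable_on {s..t}" "(\<lambda>r. G r (v r)) integrable_on {s..t}"
        using integrable_on_subinterval[OF iu sub] integrable_on_subinterval[OF iv sub] by auto
      show "G r (u r) \<le> G r (v r)" if "r \<in> {s..t}" for r
      \<comment> \<open>At \<open>r = s\<close> both drifts coincide because
        \<open>u s = v s\<close>. This also covers time 0, about which \<open>anti\<close> says
        nothing.\<close>
      proof (cases "r = s")
        case True
        with s show ?thesis by simp
      next
        case False
        with that s(4)[of r] have "v r \<le> u r" by auto
        then show ?thesis
          using anti[of r "v r" "u r"] u(2)[of r] v(2)[of r] that False sub s by auto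
      qed
    qed
    moreover have "u t - u s = integral {s..t} (\<lambda>r. G r (u r)) + (\<phi> t - \<phi> s)"
      by (rule increment_integral_equation[OF iu eu]) (use s t in auto)
    moreover have "v t - v s = integral {s..t} (\<lambda>r. G r (v r)) + (\<phi> t - \<phi> s)"
      by (rule increment_integral_equation[OF iv ev]) (use s t in auto)
    ultimately show False using s gt by linarith
  qed
  show ?thesis
    by (rule antisym; rule le; fact)
qed

text \<open>Counting from the last time at which \<open>y\<close> is at most \<open>x0\<close>, the
  drift contributes at most \<open>K * T\<close> and the forcing at most \<open>D\<close>. The drift
  enters only as a function \<open>\<rho>\<close> of time, so the bound serves the truncated
  equations and the original one alike.\<close>

lemma solution_upper_bound:
  fixes y \<rho> \<phi> :: "real \<Rightarrow> real"
  assumes y: "continuous_on {0..T} y" and int: "\<rho> integrable_on {0..T}"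
    and eq: "\<And>t. t \<in> {0..T} \<Longrightarrow> y t = x0 + integral {0..t} \<rho> + \<phi> t"
    and \<phi>0: "\<phi> 0 = 0" and D: "\<And>t s. t \<in> {0..T} \<Longrightarrow> s \<in> {0..T} \<Longrightarrow> \<phi> t - \<phi> s \<le> D"
    and \<rho>: "\<And>s. s \<in> {0..T} \<Longrightarrow> x0 \<le> y s \<Longrightarrow> \<rho> s \<le> K" and "0 \<le> K"
    and t: "t \<in> {0..T}"
  shows "y t \<le> x0 + K * T + D"
proof (cases "y t \<le> x0")
  case True
  have "0 \<le> D" using D[OF t t] by simp
  with True t \<open>0 \<le> K\<close> show ?thesis
    by (intro order_trans[OF True]) (auto intro!: mult_nonneg_nonneg)
next
  case False
  have "continuous_on {0..t} y" by (rule continuous_on_subset[OF y]) (use t in auto)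
  moreover have "y 0 \<le> x0" using eq[of 0] \<phi>0 t by auto
  ultimately obtain s where s: "0 \<le> s" "s < t" "y s = x0" "\<And>r. s < r \<Longrightarrow> r \<le> t \<Longrightarrow> x0 < y r"
    using last_time_below[of 0 t y x0] False t by auto
  have i: "\<rho> integrable_on {s..t}"
    by (rule integrable_on_subinterval[OF int]) (use s t in auto)
  have "integral {s..t} \<rho> \<le> integral {s..t} (\<lambda>_. K)"
  proof (rule integral_le[OF i])
    show "\<rho> r \<le> K" if "r \<in> {s..t}" for r
      using \<rho>[of r] s(1-3) s(4)[of r] that t by (cases "r = s") (simp_all add: less_imp_le)
  qed auto
  also have "\<dots> = K * (t - s)" using s by simp
  also have "\<dots> \<le> K * T" by (rule mult_left_mono) (use s t \<open>0 \<le> K\<close> in auto)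
  finally have "integral {s..t} \<rho> \<le> K * T" .
  moreover have "y t - y s = integral {s..t} \<rho> + (\<phi> t - \<phi> s)"
    by (rule increment_integral_equation[OF int eq]) (use s t in auto)
  moreover have "\<phi> t - \<phi> s \<le> D" using D s t by auto
  ultimately show ?thesis using s by linarith
qed

text \<open>The level \<open>\<delta>\<close> is fixed before \<open>y\<close>,
  \<open>\<rho>\<close> and \<open>\<phi>\<close>, which makes the bound uniform over all
  truncations. The lower estimate on the drift is asked for only where
  \<open>\<delta> \<le> y s < x1\<close>, a region in which a fine enough truncation changes
  nothing.\<close>

lemma solution_lower_bound:
  fixes g :: "real \<Rightarrow> real"
  assumes T: "0 < T" and C: "0 < C" and \<beta>: "0 < \<beta>" and \<alpha>: "0 < \<alpha>" "1 < \<beta> * (\<alpha> + 1)"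
    and x0: "0 < x0" and x1: "0 < x1"
    and g: "continuous_on {0..} g" "\<And>t. 0 < t \<Longrightarrow> 0 < g t"
  obtains \<delta> where "0 < \<delta>"
    "\<And>y \<rho> \<phi> t. \<lbrakk>continuous_on {0..T} y; \<rho> integrable_on {0..T};
       \<And>t. t \<in> {0..T} \<Longrightarrow> y t = x0 + integral {0..t} \<rho> + \<phi> t;
       \<phi> 0 = 0; \<And>s t. s \<in> {0..T} \<Longrightarrow> t \<in> {0..T} \<Longrightarrow> \<bar>\<phi> t - \<phi> s\<bar> \<le> C * \<bar>t - s\<bar> powr \<beta>;
       \<And>s. s \<in> {0..T} \<Longrightarrow> 0 \<le> \<rho> s;
       \<And>s. s \<in> {0..T} \<Longrightarrow> \<delta> \<le> y s \<Longrightarrow> y s < x1 \<Longrightarrow> g s * y s powr (-\<alpha>) \<le> \<rho> s;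
       t \<in> {0..T}\<rbrakk> \<Longrightarrow> \<delta> < y t"
proof -
  have small: "eventually (\<lambda>r. c * r powr e < d) (at_right 0)" if "0 < e" "0 < d" for c d e :: real
  proof (rule order_tendstoD(2)[OF _ that(2)])
    have "((\<lambda>r. r powr e) \<longlongrightarrow> 0) (at_right 0)"
      using that(1) by real_asymp
    from tendsto_mult_left[OF this, of c] show "((\<lambda>r. c * r powr e) \<longlongrightarrow> 0) (at_right 0)" by simp
  qed
  \<comment> \<open>\<open>g\<close> may vanish at time 0, so it is bounded below only on
    \<open>{\<eta>..T}\<close>. The time \<open>\<eta>\<close> is so small that the forcing moves by
    less than \<open>x0 / 2\<close> on \<open>{0..2 * \<eta>}\<close>, which excludes an early hit
    of a level below \<open>x0 / 2\<close>.\<close>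
  have "eventually (\<lambda>\<eta>. 0 < \<eta> \<and> \<eta> < T \<and> (C * 2 powr \<beta>) * \<eta> powr \<beta> < x0 / 2) (at_right 0)"
    by (intro eventually_conj small eventually_at_right_less)
      (use T \<beta> x0 in \<open>auto simp: eventually_at_right_field\<close>)
  from eventually_happens[OF this] obtain \<eta> where
    \<eta>: "0 < \<eta>" "\<eta> < T" "C * 2 powr \<beta> * \<eta> powr \<beta> < x0 / 2" by auto
  have "continuous_on {\<eta>..T} g" by (rule continuous_on_subset[OF g(1)]) (use \<eta> in auto)
  from continuous_attains_inf[OF _ _ this] \<eta> obtain z where
    z: "z \<in> {\<eta>..T}" "\<And>t. t \<in> {\<eta>..T} \<Longrightarrow> g z \<le> g t" by auto
  define c where "c = g z"
  have c: "0 < c" using g(2) z \<eta> unfolding c_def by auto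
  \<comment> \<open>\<open>r\<close> will be the length of the window before the hitting time. The
    last condition can be met because the exponent \<open>\<beta> * (\<alpha> + 1) - 1\<close> is
    positive; it is the inequality \<open>contra\<close> with
    \<open>\<delta> = C * r powr \<beta>\<close> inserted.\<close>
  have "eventually (\<lambda>r. 0 < r \<and> r < \<eta> \<and> (2 * C) * r powr \<beta> < min x0 x1
      \<and> (C * (2 * C) powr \<alpha>) * r powr (\<beta> * (\<alpha> + 1) - 1) < c) (at_right 0)"
    by (intro eventually_conj small eventually_at_right_less)
      (use \<eta> \<beta> \<alpha> x0 x1 c in \<open>auto simp: eventually_at_right_field\<close>)
  from eventually_happens[OF this] obtain r where
    r: "0 < r" "r < \<eta>" "2 * C * r powr \<beta> < x0" "2 * C * r powr \<beta> < x1"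
      "C * (2 * C) powr \<alpha> * r powr (\<beta> * (\<alpha> + 1) - 1) < c" by auto
  define \<delta> where "\<delta> = C * r powr \<beta>"
  have \<delta>: "0 < \<delta>" "\<delta> < x0 / 2" "2 * \<delta> < x1" using r C by (auto simp: \<delta>_def)
  \<comment> \<open>The push of the drift during a time \<open>r\<close> spent below
    \<open>2 * \<delta>\<close> exceeds the oscillation \<open>\<delta>\<close> of the
    forcing.\<close>
  have contra: "\<delta> < r * (c * (2 * \<delta>) powr (-\<alpha>))"
  proof -
    have "\<delta> * (2 * \<delta>) powr \<alpha> = r * (C * (2 * C) powr \<alpha> * r powr (\<beta> * (\<alpha> + 1) - 1))"
    proof -
      have "(2 * \<delta>) powr \<alpha> = (2 * C) powr \<alpha> * r powr (\<beta> * \<alpha>)"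
        using C r by (simp add: \<delta>_def powr_mult powr_powr mult.assoc[symmetric])
      then have "\<delta> * (2 * \<delta>) powr \<alpha> = C * (2 * C) powr \<alpha> * (r powr \<beta> * r powr (\<beta> * \<alpha>))"
        by (simp add: \<delta>_def)
      also have "r powr \<beta> * r powr (\<beta> * \<alpha>) = r powr 1 * r powr (\<beta> * (\<alpha> + 1) - 1)"
        unfolding powr_add[symmetric] by (simp add: algebra_simps)
      finally show ?thesis using r by (simp add: mult_ac)
    qed
    also have "\<dots> < r * c" using r by (intro mult_strict_left_mono) auto
    finally show ?thesis using \<delta> by (simp add: powr_minus field_simps)
  qed
  show ?thesis
  proof (rule that[OF \<delta>(1)])
    fix y \<rho> \<phi> :: "real \<Rightarrow> real" and t
    assume y: "continuous_on {0..T} y" and int: "\<rho> integrable_on {0..T}"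
      and eq: "\<And>t. t \<in> {0..T} \<Longrightarrow> y t = x0 + integral {0..t} \<rho> + \<phi> t"
      and \<phi>0: "\<phi> 0 = 0"
      and hoelder: "\<And>s t. s \<in> {0..T} \<Longrightarrow> t \<in> {0..T} \<Longrightarrow> \<bar>\<phi> t - \<phi> s\<bar> \<le> C * \<bar>t - s\<bar> powr \<beta>"
      and nonneg: "\<And>s. s \<in> {0..T} \<Longrightarrow> 0 \<le> \<rho> s"
      and lower: "\<And>s. s \<in> {0..T} \<Longrightarrow> \<delta> \<le> y s \<Longrightarrow> y s < x1 \<Longrightarrow> g s * y s powr (-\<alpha>) \<le> \<rho> s"
      and t: "t \<in> {0..T}"
    have integrable: "\<rho> integrable_on {a..b}" if "0 \<le> a" "b \<le> T" for a b
      by (rule integrable_on_subinterval[OF int]) (use that in auto)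
    have integral_nonneg: "0 \<le> integral {a..b} \<rho>" if "0 \<le> a" "b \<le> T" for a b
      by (rule Henstock_Kurzweil_Integration.integral_nonneg) (use that integrable nonneg in auto)
    show "\<delta> < y t"
    proof (rule ccontr)
      assume "\<not> \<delta> < y t"
      moreover have "continuous_on {0..t} y" by (rule continuous_on_subset[OF y]) (use t in auto)
      moreover have "\<delta> < y 0" using eq[of 0] \<phi>0 t \<delta> x0 by auto
      ultimately obtain t0 where t0: "0 < t0" "t0 \<le> t" "y t0 = \<delta>"
          "\<And>r. 0 \<le> r \<Longrightarrow> r < t0 \<Longrightarrow> \<delta> < y r"
        using first_hitting_time[of 0 t y \<delta>] t by auto
      \<comment> \<open>The drift is nonnegative, so before \<open>2 * \<eta>\<close> the path is
        above \<open>x0 - x0 / 2\<close>, hence above \<open>\<delta>\<close>.\<close>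
      have "2 * \<eta> \<le> t0"
      proof (rule ccontr)
        assume "\<not> 2 * \<eta> \<le> t0"
        have "\<bar>\<phi> t0 - \<phi> 0\<bar> \<le> C * t0 powr \<beta>" using hoelder[of 0 t0] t0 t by auto
        also have "\<dots> \<le> C * (2 * \<eta>) powr \<beta>"
          using C t0 \<open>\<not> 2 * \<eta> \<le> t0\<close> \<beta> by (intro mult_left_mono powr_mono2) auto
        also have "\<dots> < x0 / 2" using \<eta> by (simp add: powr_mult)
        finally have "- (x0 / 2) < \<phi> t0" using \<phi>0 by auto
        moreover have "\<delta> = x0 + integral {0..t0} \<rho> + \<phi> t0" using eq[of t0] t0 t by auto
        ultimately show False using integral_nonneg[of 0 t0] t0 t \<delta> by auto
      qed
      then have lo: "\<eta> \<le> t0 - r" using r by auto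
      have incr: "\<delta> - y s = integral {s..t0} \<rho> + (\<phi> t0 - \<phi> s)"
        and incr_\<phi>: "\<bar>\<phi> t0 - \<phi> s\<bar> \<le> \<delta>" if "s \<in> {t0 - r..t0}" for s
      proof -
        have s: "0 \<le> s" "s \<le> t0" "t0 \<le> T" using that lo \<eta> t0 t by auto
        show "\<delta> - y s = integral {s..t0} \<rho> + (\<phi> t0 - \<phi> s)"
          using increment_integral_equation[OF int eq s] t0 by simp
        have "\<bar>\<phi> t0 - \<phi> s\<bar> \<le> C * \<bar>t0 - s\<bar> powr \<beta>" by (rule hoelder) (use s in auto)
        also have "\<dots> \<le> \<delta>" unfolding \<delta>_def
          using C that \<beta> by (intro mult_left_mono powr_mono2) auto
        finally show "\<bar>\<phi> t0 - \<phi> s\<bar> \<le> \<delta>" .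
      qed
      \<comment> \<open>Going back from \<open>t0\<close>, the drift only lowers the path and the
        forcing changes it by at most \<open>\<delta>\<close>, so
        \<open>y s \<le> 2 * \<delta>\<close> on the whole window; minimality of \<open>t0\<close>
        gives \<open>\<delta> \<le> y s\<close>.\<close>
      have "c * (2 * \<delta>) powr (-\<alpha>) \<le> \<rho> s" if s: "s \<in> {t0 - r..t0}" for s
      proof -
        have s': "s \<in> {\<eta>..T}" using s lo t0 t by auto
        have "0 \<le> integral {s..t0} \<rho>" using integral_nonneg s' t0 t \<eta> by auto
        then have "y s \<le> 2 * \<delta>" using incr[OF s] incr_\<phi>[OF s] by linarith
        moreover have "\<delta> \<le> y s" using t0 s' s \<eta> by (cases "s = t0") (auto intro: less_imp_le)
        ultimately have *: "\<delta> \<le> y s" "y s \<le> 2 * \<delta>" by auto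
        have "c * (2 * \<delta>) powr (-\<alpha>) \<le> g s * y s powr (-\<alpha>)"
          using z(2)[OF s'] c * \<delta> \<alpha> unfolding c_def
          by (intro mult_mono powr_mono2') auto
        also have "\<dots> \<le> \<rho> s" by (rule lower) (use * \<delta> s' \<eta> in auto)
        finally show ?thesis .
      qed
      then have "integral {t0 - r..t0} (\<lambda>_. c * (2 * \<delta>) powr (-\<alpha>)) \<le> integral {t0 - r..t0} \<rho>"
        by (intro integral_le integrable) (use lo \<eta> t0 t in auto)
      then have "r * (c * (2 * \<delta>) powr (-\<alpha>)) \<le> integral {t0 - r..t0} \<rho>"
        using r by (simp add: mult_ac)
      \<comment> \<open>The path must descend over the window, yet the drift raises it by more than
        \<open>\<delta>\<close> and the forcing lowers it by at most
        \<open>\<delta>\<close>.\<close>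
      moreover have "\<delta> < y (t0 - r)" using t0(4)[of "t0 - r"] lo \<eta> r by auto
      ultimately show False
        using incr[of "t0 - r"] incr_\<phi>[of "t0 - r"] contra r by auto
    qed
  qed
qed

section \<open>Picard iteration\<close>

lemma continuous_on_atLeast:
  fixes u :: "real \<Rightarrow> real"
  assumes "\<And>T. continuous_on {a..T} u"
  shows "continuous_on {a..} u"
  unfolding continuous_on_eq_continuous_within
proof
  fix x assume x: "x \<in> {a..}"
  have "at x within {a..} = at x within {a..x + 1}"
    by (rule at_within_nhd[of x "{..<x + 1}"]) auto
  moreover have "continuous (at x within {a..x + 1}) u"
    using assms[of "x + 1"] x by (simp add: continuous_on_eq_continuous_within)
  ultimately show "continuous (at x within {a..}) u" by (simp add: continuous_within)
qed

text \<open>Continuity in time makes the process a pointwise limit of its time discretisations,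
  hence jointly measurable; integrating out the time then preserves measurability.\<close>

lemma borel_measurable_integral_process:
  fixes Z :: "real \<Rightarrow> 'w \<Rightarrow> real"
  assumes T: "0 \<le> T"
    and meas: "\<And>t. t \<in> {0..T} \<Longrightarrow> Z t \<in> borel_measurable M"
    and cont: "\<And>\<omega>. \<omega> \<in> space M \<Longrightarrow> continuous_on {0..T} (\<lambda>t. Z t \<omega>)"
  shows "(\<lambda>\<omega>. integral {0..T} (\<lambda>t. Z t \<omega>)) \<in> borel_measurable M"
proof -
  \<comment> \<open>Discretised times may leave \<open>{0..T}\<close>, outside of which nothing is
    known about \<open>Z\<close>.\<close>
  define clip where "clip s = max 0 (min T s)" for s
  have clip: "clip s \<in> {0..T}" for s using T by (auto simp: clip_def)
  have joint: "(\<lambda>p. Z (clip (snd p)) (fst p)) \<in> borel_measurable (M \<Otimes>\<^sub>M lborel)"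
  proof (rule borel_measurable_LIMSEQ_real)
    fix p :: "'w \<times> real" assume "p \<in> space (M \<Otimes>\<^sub>M lborel)"
    then have \<omega>: "fst p \<in> space M" by (auto simp: space_pair_measure)
    have "(\<lambda>n. clip (\<lfloor>real (Suc n) * snd p\<rfloor> / real (Suc n))) \<longlonglongrightarrow> clip (snd p)"
      unfolding clip_def by (intro tendsto_intros) real_asymp
    then show "(\<lambda>n. Z (clip (\<lfloor>real (Suc n) * snd p\<rfloor> / real (Suc n))) (fst p))
        \<longlonglongrightarrow> Z (clip (snd p)) (fst p)"
      by (rule continuous_on_tendsto_compose[OF cont[OF \<omega>]]) (use clip in auto)
  next
    fix n
    show "(\<lambda>p. Z (clip (\<lfloor>real (Suc n) * snd p\<rfloor> / real (Suc n))) (fst p))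
        \<in> borel_measurable (M \<Otimes>\<^sub>M lborel)"
    \<comment> \<open>The floor takes countably many integer values, and for each of them the
      sampling time is deterministic.\<close>
    proof (rule measurable_compose_countable[where f = "\<lambda>i p. Z (clip (real_of_int i / real (Suc n))) (fst p)"])
      show "(\<lambda>p. Z (clip (real_of_int i / real (Suc n))) (fst p)) \<in> borel_measurable (M \<Otimes>\<^sub>M lborel)" for i
        by (rule measurable_compose[OF measurable_fst meas[OF clip]])
    qed measurable
  qed
  have "(\<lambda>\<omega>. LINT s|lborel. indicat_real {0..T} s *\<^sub>R Z (clip s) \<omega>) \<in> borel_measurable M"
    by (rule lborel.borel_measurable_lebesgue_integral)
      (use joint in \<open>simp add: case_prod_beta\<close>)
  moreover have "(LINT s|lborel. indicat_real {0..T} s *\<^sub>R Z (clip s) \<omega>) = integral {0..T} (\<lambda>t. Z t \<omega>)"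
    if "\<omega> \<in> space M" for \<omega>
  proof -
    have "(LINT s|lborel. indicat_real {0..T} s *\<^sub>R Z (clip s) \<omega>) = (LINT s:{0..T}|lborel. Z s \<omega>)"
      unfolding set_lebesgue_integral_def
      by (rule Bochner_Integration.integral_cong) (auto simp: clip_def indicator_def)
    also have "\<dots> = integral {0..T} (\<lambda>t. Z t \<omega>)"
      by (rule set_borel_integral_eq_integral(2)[OF borel_integrable_atLeastAtMost'[OF cont[OF that]]])
    finally show ?thesis .
  qed
  ultimately show ?thesis by (simp cong: measurable_cong)
qed

text \<open>The forcing \<open>\<phi>\<close> includes the initial value and is also the starting
  guess.\<close>

primrec picard :: "(real \<Rightarrow> real \<Rightarrow> real) \<Rightarrow> (real \<Rightarrow> real) \<Rightarrow> nat \<Rightarrow> real \<Rightarrow> real" where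
  "picard G \<phi> 0 = \<phi>"
| "picard G \<phi> (Suc k) = (\<lambda>t. \<phi> t + integral {0..t} (\<lambda>s. G s (picard G \<phi> k s)))"

locale lipschitz_drift =
  fixes G :: "real \<Rightarrow> real \<Rightarrow> real"
  assumes continuous: "continuous_on ({0..} \<times> UNIV) (\<lambda>(t, x). G t x)"
    and lipschitz: "\<And>T. \<exists>L. \<forall>t\<in>{0..T}. \<forall>x y. \<bar>G t x - G t y\<bar> \<le> L * \<bar>x - y\<bar>"
begin

lemma continuous_on_drift:
  assumes "continuous_on A u" "A \<subseteq> {0..}"
  shows "continuous_on A (\<lambda>s. G s (u s))"
proof -
  have "continuous_on A (\<lambda>s. (\<lambda>(t, x). G t x) (s, u s))"
    by (rule continuous_on_compose2[OF continuous])
      (use assms in \<open>auto intro!: continuous_intros\<close>)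
  then show ?thesis by simp
qed

lemma continuous_on_picard:
  assumes "continuous_on {0..} \<phi>"
  shows "continuous_on {0..} (picard G \<phi> k)"
proof (induction k)
  case (Suc k)
  have "continuous_on {0..T} (\<lambda>t. integral {0..t} (\<lambda>s. G s (picard G \<phi> k s)))" for T
    by (intro indefinite_integral_continuous_1 integrable_continuous_real continuous_on_drift
        continuous_on_subset[OF Suc.IH]) auto
  then show ?case using assms by (auto intro!: continuous_on_add intro: continuous_on_atLeast)
qed (use assms in simp)

text \<open>Every iterate is built from the path by countable limits and integrals. Solutions
  obtained as explicit limits of iterates are therefore random variables, with no measurable
  selection involved.\<close>

lemma picard_measurable:
  assumes \<phi>: "\<And>t. 0 \<le> t \<Longrightarrow> \<phi> t \<in> borel_measurable M"
    and cont: "\<And>\<omega>. \<omega> \<in> space M \<Longrightarrow> continuous_on {0..} (\<lambda>t. \<phi> t \<omega>)"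
    and "0 \<le> t"
  shows "(\<lambda>\<omega>. picard G (\<lambda>t. \<phi> t \<omega>) k t) \<in> borel_measurable M"
  using \<open>0 \<le> t\<close>
proof (induction k arbitrary: t)
  case (Suc k)
  have "(\<lambda>\<omega>. integral {0..t} (\<lambda>s. G s (picard G (\<lambda>t. \<phi> t \<omega>) k s))) \<in> borel_measurable M"
  proof (rule borel_measurable_integral_process[OF Suc.prems])
    show "(\<lambda>\<omega>. G s (picard G (\<lambda>t. \<phi> t \<omega>) k s)) \<in> borel_measurable M" if s: "s \<in> {0..t}" for s
    proof (rule borel_measurable_continuous_on[where f = "G s"])
      have "continuous_on UNIV (\<lambda>x. (\<lambda>(t, x). G t x) (s, x))"
        by (rule continuous_on_compose2[OF continuous]) (use s in \<open>auto intro!: continuous_intros\<close>)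
      then show "continuous_on UNIV (G s)" by simp
    qed (use Suc.IH s in auto)
    show "continuous_on {0..t} (\<lambda>s. G s (picard G (\<lambda>t. \<phi> t \<omega>) k s))" if "\<omega> \<in> space M" for \<omega>
      by (intro continuous_on_drift continuous_on_subset[OF continuous_on_picard[OF cont[OF that]]]) auto
  qed
  then show ?case using \<phi>[OF Suc.prems] by simp
qed (use \<phi> in simp)

text \<open>In the norm weighted by \<open>exp (- 2 * L * t)\<close> the Picard map contracts by the
  factor 1/2, since integrating \<open>L * exp (2 * L * s)\<close> costs \<open>L\<close> and gains
  \<open>1 / (2 * L)\<close>.\<close>

lemma picard_increment:
  assumes \<phi>: "continuous_on {0..} \<phi>" and L: "0 < L"
    and lip: "\<And>t x y. t \<in> {0..T} \<Longrightarrow> \<bar>G t x - G t y\<bar> \<le> L * \<bar>x - y\<bar>"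
    and A: "\<And>t. t \<in> {0..T} \<Longrightarrow> \<bar>picard G \<phi> 1 t - \<phi> t\<bar> \<le> A" and t: "t \<in> {0..T}"
  shows "\<bar>picard G \<phi> (Suc k) t - picard G \<phi> k t\<bar> \<le> A * (1 / 2) ^ k * exp (2 * L * t)"
  using t
proof (induction k arbitrary: t)
  case 0
  then have "0 \<le> A" using A[of t] by linarith
  then have "A * 1 \<le> A * exp (2 * L * t)" using 0 L by (intro mult_left_mono) auto
  then show ?case using A[OF 0] by simp
next
  case (Suc k)
  let ?p = "picard G \<phi>"
  have int: "(\<lambda>s. G s (?p k s)) integrable_on {0..t}" for k
    by (intro integrable_continuous_real continuous_on_drift
        continuous_on_subset[OF continuous_on_picard[OF \<phi>]]) auto
  have "((\<lambda>s. L * (A * (1 / 2) ^ k * exp (2 * L * s))) has_integral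
      A * (1 / 2) ^ Suc k * exp (2 * L * t) - A * (1 / 2) ^ Suc k * exp (2 * L * 0)) {0..t}"
    by (rule fundamental_theorem_of_calculus)
      (use Suc.prems in \<open>auto intro!: derivative_eq_intros simp: has_real_derivative_iff_has_vector_derivative[symmetric]\<close>)
  note E = this
  have "\<bar>integral {0..t} (\<lambda>s. G s (?p (Suc k) s) - G s (?p k s))\<bar>
      \<le> integral {0..t} (\<lambda>s. L * (A * (1 / 2) ^ k * exp (2 * L * s)))"
  proof (rule integral_norm_bound_integral[where 'a = real, unfolded real_norm_def])
    fix s assume s: "s \<in> {0..t}"
    have "\<bar>G s (?p (Suc k) s) - G s (?p k s)\<bar> \<le> L * \<bar>?p (Suc k) s - ?p k s\<bar>"
      by (rule lip) (use s Suc.prems in auto)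
    also have "\<dots> \<le> L * (A * (1 / 2) ^ k * exp (2 * L * s))"
      by (intro mult_left_mono Suc.IH) (use s Suc.prems L in auto)
    finally show "\<bar>G s (?p (Suc k) s) - G s (?p k s)\<bar> \<le> L * (A * (1 / 2) ^ k * exp (2 * L * s))" .
  qed (rule integrable_diff[OF int int], rule has_integral_integrable[OF E])
  also have "\<dots> \<le> A * (1 / 2) ^ Suc k * exp (2 * L * t)"
  proof -
    have "0 \<le> A" using A[OF Suc.prems] by linarith
    then show ?thesis using integral_unique[OF E] by simp
  qed
  also have "integral {0..t} (\<lambda>s. G s (?p (Suc k) s) - G s (?p k s))
      = ?p (Suc (Suc k)) t - ?p (Suc k) t"
    using Henstock_Kurzweil_Integration.integral_diff[OF int int, of "Suc k" k] by simp
  finally show ?case by (simp del: picard.simps)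
qed

text \<open>The increments are summable uniformly on each compact time interval, so the iterates
  converge uniformly there. The Lipschitz bound carries this over to the integrands, and the
  equation survives the limit.\<close>

lemma picard_limit:
  assumes \<phi>: "continuous_on {0..} \<phi>"
  defines "y \<equiv> \<lambda>t. lim (\<lambda>k. picard G \<phi> k t)"
  shows "continuous_on {0..} y"
    and "0 \<le> t \<Longrightarrow> y t = \<phi> t + integral {0..t} (\<lambda>s. G s (y s))"
proof -
  let ?p = "picard G \<phi>"
  have ulim: "uniform_limit {0..T} ?p y sequentially" for T
  proof -
    obtain L' where L': "\<And>t x y. t \<in> {0..T} \<Longrightarrow> \<bar>G t x - G t y\<bar> \<le> L' * \<bar>x - y\<bar>"
      using lipschitz[of T] by blast
    \<comment> \<open>The Lipschitz assumption gives no sign for \<open>L'\<close>, whereas the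
      contraction estimate needs a positive constant.\<close>
    define L where "L = max 1 L'"
    have L: "0 < L" "\<bar>G t x - G t y\<bar> \<le> L * \<bar>x - y\<bar>" if "t \<in> {0..T}" for t x y
      using order_trans[OF L'[OF that] mult_right_mono[of L' L]] by (auto simp: L_def)
    have "compact ((\<lambda>t. ?p 1 t - \<phi> t) ` {0..T})"
      by (intro compact_continuous_image continuous_on_diff
          continuous_on_subset[OF continuous_on_picard[OF \<phi>]] continuous_on_subset[OF \<phi>]) auto
    from compact_imp_bounded[OF this]
    obtain A where A: "\<And>t. t \<in> {0..T} \<Longrightarrow> \<bar>?p 1 t - \<phi> t\<bar> \<le> A"
      unfolding bounded_iff by (metis imageI real_norm_def)
    \<comment> \<open>The partial sums telescope to the iterates minus \<open>\<phi>\<close>, so the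
      Weierstrass test yields uniform convergence of the iterates.\<close>
    have "uniform_limit {0..T} (\<lambda>n t. \<Sum>i<n. ?p (Suc i) t - ?p i t)
        (\<lambda>t. \<Sum>i. ?p (Suc i) t - ?p i t) sequentially"
    proof (rule Weierstrass_m_test)
      fix k t assume t: "t \<in> {0..T}"
      have "\<bar>?p (Suc k) t - ?p k t\<bar> \<le> A * (1 / 2) ^ k * exp (2 * L * t)"
        by (rule picard_increment[OF \<phi> L A t]) (use t in auto)
      also have "\<dots> \<le> A * (1 / 2) ^ k * exp (2 * L * T)"
        using A[OF t] L[OF t] t by (intro mult_left_mono mult_nonneg_nonneg) auto
      finally show "norm (?p (Suc k) t - ?p k t) \<le> A * (1 / 2) ^ k * exp (2 * L * T)"
        by (simp del: picard.simps)
    next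
      show "summable (\<lambda>k. A * (1 / 2) ^ k * exp (2 * L * T))"
        by (intro summable_mult summable_mult2 summable_geometric) auto
    qed
    moreover have "(\<Sum>i<n. ?p (Suc i) t - ?p i t) = ?p n t - \<phi> t" for n t
      by (subst sum_lessThan_telescope) simp
    ultimately have "uniform_limit {0..T} (\<lambda>n t. ?p n t - \<phi> t) (\<lambda>t. \<Sum>i. ?p (Suc i) t - ?p i t) sequentially"
      by (simp del: picard.simps)
    from uniform_limit_add[OF this uniform_limit_const[of \<phi>]]
    have *: "uniform_limit {0..T} ?p (\<lambda>t. (\<Sum>i. ?p (Suc i) t - ?p i t) + \<phi> t) sequentially"
      by (simp del: picard.simps)
    have "y t = (\<Sum>i. ?p (Suc i) t - ?p i t) + \<phi> t" if "t \<in> {0..T}" for t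
      unfolding y_def by (rule limI) (rule tendsto_uniform_limitI[OF * that])
    then show ?thesis by (subst uniform_limit_cong'[OF refl]) (use * in auto)
  qed
  show cont: "continuous_on {0..} y"
  proof (rule continuous_on_atLeast)
    fix T show "continuous_on {0..T} y"
      by (rule uniform_limit_theorem[OF _ ulim])
        (auto intro!: always_eventually continuous_on_subset[OF continuous_on_picard[OF \<phi>]])
  qed
  show "y t = \<phi> t + integral {0..t} (\<lambda>s. G s (y s))" if t: "0 \<le> t"
  proof -
    obtain L where L: "\<And>s x y. s \<in> {0..t} \<Longrightarrow> \<bar>G s x - G s y\<bar> \<le> L * \<bar>x - y\<bar>"
      using lipschitz[of t] by blast
    have "uniform_limit {0..t} (\<lambda>k s. G s (?p k s)) (\<lambda>s. G s (y s)) sequentially"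
    proof (rule uniform_limitI)
      fix e :: real assume e: "0 < e"
      define d where "d = e / (\<bar>L\<bar> + 1)"
      have d: "0 < d" using e by (simp add: d_def)
      show "\<forall>\<^sub>F k in sequentially. \<forall>s\<in>{0..t}. dist (G s (?p k s)) (G s (y s)) < e"
        using uniform_limitD[OF ulim[of t] d]
      proof (rule eventually_mono, intro ballI)
        fix k s assume "\<forall>s\<in>{0..t}. dist (?p k s) (y s) < d" and s: "s \<in> {0..t}"
        then have *: "\<bar>?p k s - y s\<bar> < d" by (auto simp: dist_real_def)
        have "\<bar>G s (?p k s) - G s (y s)\<bar> \<le> L * \<bar>?p k s - y s\<bar>" by (rule L[OF s])
        also have "\<dots> \<le> (\<bar>L\<bar> + 1) * \<bar>?p k s - y s\<bar>" by (rule mult_right_mono) auto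
        also have "\<dots> < (\<bar>L\<bar> + 1) * d" using * by (intro mult_strict_left_mono) auto
        also have "\<dots> = e" by (simp add: d_def)
        finally show "dist (G s (?p k s)) (G s (y s)) < e" by (simp add: dist_real_def)
      qed
    qed
    moreover have "continuous_on {0..t} (\<lambda>s. G s (?p k s))" for k
      by (intro continuous_on_drift continuous_on_subset[OF continuous_on_picard[OF \<phi>]]) auto
    ultimately obtain I J where I: "\<And>k. ((\<lambda>s. G s (?p k s)) has_integral I k) {0..t}"
      and J: "((\<lambda>s. G s (y s)) has_integral J) {0..t}" and "I \<longlonglongrightarrow> J"
      by (rule uniform_limit_integral) auto
    then have "(\<lambda>k. integral {0..t} (\<lambda>s. G s (?p k s))) \<longlonglongrightarrow> integral {0..t} (\<lambda>s. G s (y s))"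
      by (simp add: integral_unique[OF I] integral_unique[OF J])
    then have "(\<lambda>k. ?p (Suc k) t) \<longlonglongrightarrow> \<phi> t + integral {0..t} (\<lambda>s. G s (y s))"
      by (simp add: tendsto_add)
    moreover have "(\<lambda>k. ?p (Suc k) t) \<longlonglongrightarrow> y t"
      by (rule LIMSEQ_Suc, rule tendsto_uniform_limitI[OF ulim[of t]]) (use t in simp)
    ultimately show ?thesis by (rule LIMSEQ_unique[rotated])
  qed
qed

end

section \<open>Hoelder continuity of sample paths\<close>

text \<open>Chaining: both points are joined to their dyadic approximations at a level comparable to
  their distance, where these approximations coincide or are neighbours. In the constant,
  \<open>2 / (1 - 2 powr - \<beta>)\<close> comes from the two chains, 1 from the neighbouring pair,
  and \<open>2 powr \<beta>\<close> from replacing the mesh size by the distance.\<close>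

lemma dyadic_increments_hoelder:
  fixes \<psi> :: "real \<Rightarrow> real"
  assumes cont: "continuous_on {0..1} \<psi>" and \<beta>: "0 < \<beta>" and K: "0 \<le> K"
    and incr: "\<And>n j. j < 2 ^ n \<Longrightarrow>
      \<bar>\<psi> (real (Suc j) / 2 ^ n) - \<psi> (real j / 2 ^ n)\<bar> \<le> K * (2 powr - \<beta>) ^ n"
    and s: "s \<in> {0..1}" and t: "t \<in> {0..1}"
  shows "\<bar>\<psi> t - \<psi> s\<bar> \<le> 2 powr \<beta> * (2 / (1 - 2 powr - \<beta>) + 1) * K * \<bar>t - s\<bar> powr \<beta>"
proof -
  define q :: real where "q = 2 powr - \<beta>"
  have q: "0 < q" "q < 1" using \<beta> by (auto simp: q_def powr_less_one)
  \<comment> \<open>\<open>d n x\<close> is the largest level-\<open>n\<close> dyadic point not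
    exceeding \<open>x\<close>, and \<open>i n x\<close> is its index.\<close>
  define i where "i n x = nat \<lfloor>2 ^ n * x\<rfloor>" for n :: nat and x :: real
  define d where "d n x = real (i n x) / 2 ^ n" for n :: nat and x :: real
  have i: "real (i n x) \<le> 2 ^ n * x" "2 ^ n * x < real (i n x) + 1" if "x \<in> {0..1}" for n x
    using that by (auto simp: i_def)
  have d: "d n x \<le> x" "x < d n x + 1 / 2 ^ n" if "x \<in> {0..1}" for n x
    using i[OF that, of n] by (auto simp: d_def field_simps)
  have d01: "d n x \<in> {0..1}" if "x \<in> {0..1}" for n x
  proof -
    have "0 \<le> d n x" by (simp add: d_def)
    then show ?thesis using d(1)[OF that, of n] that by auto
  qed
  \<comment> \<open>Refining by one level either keeps the approximation or moves it to its right
    neighbour on the finer grid.\<close>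
  have step: "\<bar>\<psi> (d (Suc n) x) - \<psi> (d n x)\<bar> \<le> K * q ^ Suc n" if x: "x \<in> {0..1}" for n x
  proof -
    have "2 * i n x \<le> i (Suc n) x" "i (Suc n) x < 2 * i n x + 2"
      using i[OF x, of n] i[OF x, of "Suc n"] by simp_all
    then consider "i (Suc n) x = 2 * i n x" | "i (Suc n) x = Suc (2 * i n x)" by linarith
    then show ?thesis
    proof cases
      case 1
      then show ?thesis using K q by (simp add: d_def)
    next
      case 2
      \<comment> \<open>\<open>incr\<close> requires the left index to be strictly below
        \<open>2 ^ Suc n\<close>; this holds because its successor is still an index of a point in
        the unit interval.\<close>
      have "2 ^ Suc n * x \<le> 2 ^ Suc n" using x by (intro mult_left_le) auto
      with i(1)[OF x, of "Suc n"] have "real (i (Suc n) x) \<le> 2 ^ Suc n" by linarith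
      then have "real (Suc (2 * i n x)) \<le> real (2 ^ Suc n)" using 2 by simp
      then have "2 * i n x < 2 ^ Suc n" by (simp only: of_nat_le_iff Suc_le_eq)
      from incr[OF this] 2 show ?thesis by (simp add: d_def q_def)
    qed
  qed
  \<comment> \<open>The steps from level \<open>n\<close> onwards sum to a geometric series, and
    continuity of \<open>\<psi>\<close> passes the bound from the approximations to
    \<open>x\<close>.\<close>
  have tail: "\<bar>\<psi> x - \<psi> (d n x)\<bar> \<le> K * q ^ n / (1 - q)" if x: "x \<in> {0..1}" for n x
  proof (rule LIMSEQ_le_const2)
    have "(\<lambda>m. d m x) \<longlonglongrightarrow> x"
    proof (rule tendsto_sandwich[OF _ _ _ tendsto_const])
      show "(\<lambda>m. x - 1 / 2 ^ m) \<longlonglongrightarrow> x" by real_asymp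
    qed (use d[OF x] in \<open>auto intro!: always_eventually less_imp_le simp: diff_less_eq\<close>)
    then have "(\<lambda>m. d (m + n) x) \<longlonglongrightarrow> x" by (rule LIMSEQ_ignore_initial_segment)
    then have "(\<lambda>m. \<psi> (d (m + n) x)) \<longlonglongrightarrow> \<psi> x"
      by (rule continuous_on_tendsto_compose[OF cont]) (use x d01 in auto)
    then show "(\<lambda>m. \<bar>\<psi> (d (m + n) x) - \<psi> (d n x)\<bar>) \<longlonglongrightarrow> \<bar>\<psi> x - \<psi> (d n x)\<bar>"
      by (intro tendsto_intros)
    have "\<bar>\<psi> (d (m + n) x) - \<psi> (d n x)\<bar> \<le> K * q ^ n * (1 - q ^ m) / (1 - q)" for m
    proof (induction m)
      case (Suc m)
      have "\<bar>\<psi> (d (Suc m + n) x) - \<psi> (d n x)\<bar> \<le> K * q ^ Suc (m + n) + K * q ^ n * (1 - q ^ m) / (1 - q)"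
        using step[OF x, of "m + n"] Suc.IH by simp
      also have "\<dots> \<le> K * q ^ (m + n) + K * q ^ n * (1 - q ^ m) / (1 - q)"
        using K q by (intro add_right_mono mult_left_mono) (auto intro: mult_left_le_one_le)
      also have "\<dots> = K * q ^ n * (1 - q ^ Suc m) / (1 - q)"
        using q by (simp add: field_simps power_add)
      finally show ?case .
    qed simp
    also have "K * q ^ n * (1 - q ^ m) / (1 - q) \<le> K * q ^ n / (1 - q)" for m
      using K q by (intro divide_right_mono mult_left_le) auto
    finally show "\<exists>N. \<forall>m\<ge>N. \<bar>\<psi> (d (m + n) x) - \<psi> (d n x)\<bar> \<le> K * q ^ n / (1 - q)" by auto
  qed
  have main: "\<bar>\<psi> t - \<psi> s\<bar> \<le> 2 powr \<beta> * (2 / (1 - q) + 1) * K * (t - s) powr \<beta>"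
    if s: "s \<in> {0..1}" and t: "t \<in> {0..1}" and "s < t" for s t
  proof -
    obtain k where "(1 / 2) ^ k < t - s"
      using real_arch_pow_inv[of "t - s" "1 / 2"] \<open>s < t\<close> by auto
    \<comment> \<open>With \<open>n = m - 1\<close>, minimality places \<open>t - s\<close> between
      half the mesh \<open>1 / 2 ^ n\<close> and the mesh itself. The upper bound makes the indices
      differ by at most one; the lower bound converts \<open>q ^ n\<close> into a power of
      \<open>t - s\<close>.\<close>
    define m where "m = (LEAST k. (1 / 2) ^ k < t - s)"
    have m: "(1 / 2) ^ m < t - s"
      unfolding m_def by (rule LeastI) fact
    with s t have "m \<noteq> 0" by (intro notI) auto
    then obtain n where n: "m = Suc n" by (cases m) auto
    have "\<not> (1 / 2) ^ n < t - s"
      by (rule not_less_Least) (use n in \<open>simp add: m_def\<close>)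
    then have lo: "1 / 2 ^ n < 2 * (t - s)" and hi: "2 ^ n * (t - s) \<le> 1"
      using m n by (auto simp: power_one_over field_simps)
    have "2 ^ n * t \<le> 2 ^ n * s + 1" using hi by (simp add: right_diff_distrib)
    moreover have "2 ^ n * s < 2 ^ n * t" using \<open>s < t\<close> by simp
    ultimately have "i n t < i n s + 2" "i n s < i n t + 1"
      using i[OF s, of n] i[OF t, of n] by linarith+
    then consider "i n t = i n s" | "i n t = Suc (i n s)" by linarith
    then have mid: "\<bar>\<psi> (d n t) - \<psi> (d n s)\<bar> \<le> K * q ^ n"
    proof cases
      case 1
      then show ?thesis using K q by (simp add: d_def)
    next
      case 2
      have "2 ^ n * t \<le> 2 ^ n" using t by (intro mult_left_le) auto
      with i(1)[OF t, of n] have "real (i n t) \<le> 2 ^ n" by linarith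
      then have "real (Suc (i n s)) \<le> real (2 ^ n)" using 2 by simp
      then have "i n s < 2 ^ n" by (simp only: of_nat_le_iff Suc_le_eq)
      from incr[OF this] 2 show ?thesis by (simp add: d_def q_def)
    qed
    have "\<bar>\<psi> t - \<psi> s\<bar> \<le> K * q ^ n / (1 - q) + K * q ^ n + K * q ^ n / (1 - q)"
      using tail[OF t, of n] tail[OF s, of n] mid by linarith
    also have "\<dots> = (2 / (1 - q) + 1) * K * q ^ n"
      by (simp add: divide_inverse algebra_simps)
    also have "q ^ n = (1 / 2 ^ n) powr \<beta>"
      by (simp add: q_def powr_realpow[symmetric] powr_powr powr_divide powr_minus field_simps)
    also have "(2 / (1 - q) + 1) * K * (1 / 2 ^ n) powr \<beta>
        \<le> (2 / (1 - q) + 1) * K * (2 * (t - s)) powr \<beta>"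
      using lo \<beta> K q by (intro mult_left_mono powr_mono2 mult_nonneg_nonneg) auto
    also have "\<dots> = 2 powr \<beta> * (2 / (1 - q) + 1) * K * (t - s) powr \<beta>"
      using \<open>s < t\<close> by (subst powr_mult) auto
    finally show ?thesis .
  qed
  show ?thesis
    using main[OF s t] main[OF t s] unfolding q_def[symmetric]
    by (cases s t rule: linorder_cases) (auto simp: abs_minus_commute)
qed

text \<open>The Kolmogorov--Chentsov argument with control of the constant: the \<open>m\<close>-th
  root of one integrable random series bounds all normalised dyadic increments, and chaining extends
  the bound to all pairs of times.\<close>

lemma kolmogorov_hoelder:
  fixes Z :: "real \<Rightarrow> 'w \<Rightarrow> real" and m :: nat and \<beta> \<delta> c :: real
  assumes m: "0 < m" and \<beta>: "0 < \<beta>" and c: "0 \<le> c" and \<delta>: "m * \<beta> < \<delta>"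
    and meas: "\<And>t. t \<in> {0..1} \<Longrightarrow> Z t \<in> borel_measurable M"
    and cont: "\<And>\<omega>. \<omega> \<in> space M \<Longrightarrow> continuous_on {0..1} (\<lambda>t. Z t \<omega>)"
    and moment: "\<And>s t. s \<in> {0..1} \<Longrightarrow> t \<in> {0..1} \<Longrightarrow>
      (\<integral>\<^sup>+\<omega>. ennreal (\<bar>Z t \<omega> - Z s \<omega>\<bar> ^ m) \<partial>M) \<le> ennreal (c * \<bar>t - s\<bar> powr (1 + \<delta>))"
  obtains K where "K \<in> borel_measurable M" "\<And>\<omega>. 0 \<le> K \<omega>" "integrable M (\<lambda>\<omega>. K \<omega> ^ m)"
    "AE \<omega> in M. \<forall>s\<in>{0..1}. \<forall>t\<in>{0..1}. \<bar>Z t \<omega> - Z s \<omega>\<bar> \<le> K \<omega> * \<bar>t - s\<bar> powr \<beta>"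
proof -
  define \<Delta> where "\<Delta> n j \<omega> = Z (real (Suc j) / 2 ^ n) \<omega> - Z (real j / 2 ^ n) \<omega>" for n j :: nat and \<omega>
  define w where "w n = (2 powr \<beta>) ^ (n * m)" for n
  \<comment> \<open>\<open>S\<close> dominates every weighted dyadic increment at once and has finite mean.\<close>
  define S where "S \<omega> = (\<Sum>n. \<Sum>j<2^n. ennreal (w n * \<bar>\<Delta> n j \<omega>\<bar> ^ m))" for \<omega>
  \<comment> \<open>Level \<open>n\<close> has \<open>2 ^ n\<close> increments, each with weight
    \<open>2 powr (n * m * \<beta>)\<close> and \<open>m\<close>-th moment at most
    \<open>c * 2 powr (- n * (1 + \<delta>))\<close>. It contributes at most
    \<open>c * r ^ n\<close> to the mean of \<open>S\<close>, and
    \<open>\<delta> > m * \<beta>\<close> makes \<open>r < 1\<close>.\<close>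
  define r :: real where "r = 2 powr (m * \<beta> - \<delta>)"
  have r: "0 < r" "r < 1" using \<delta> by (auto simp: r_def powr_less_one)
  have grid: "real (Suc j) / 2 ^ n \<in> {0..1}" "real j / 2 ^ n \<in> {0..1}" if "j < 2 ^ n" for j n
  proof -
    have "real (Suc j) \<le> real (2 ^ n)" using that by (subst of_nat_le_iff) auto
    then show "real (Suc j) / 2 ^ n \<in> {0..1}" "real j / 2 ^ n \<in> {0..1}"
      using that by (auto simp: field_simps)
  qed
  have \<Delta>_meas [measurable]: "\<Delta> n j \<in> borel_measurable M" if "j < 2 ^ n" for n j
    unfolding \<Delta>_def using meas grid[OF that] by measurable
  have term_meas: "(\<lambda>\<omega>. ennreal (w n * \<bar>\<Delta> n j \<omega>\<bar> ^ m)) \<in> borel_measurable M" if "j \<in> {..<2 ^ n}" for n j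
    using \<Delta>_meas[of j n] that by simp
  have S_meas [measurable]: "S \<in> borel_measurable M"
    unfolding S_def using term_meas by (intro borel_measurable_suminf_order borel_measurable_sum) auto
  have "(\<integral>\<^sup>+\<omega>. S \<omega> \<partial>M) = (\<Sum>n. \<Sum>j<2^n. \<integral>\<^sup>+\<omega>. ennreal (w n * \<bar>\<Delta> n j \<omega>\<bar> ^ m) \<partial>M)"
    unfolding S_def using term_meas
    by (subst nn_integral_suminf) (auto intro!: suminf_cong nn_integral_sum borel_measurable_sum)
  also have "\<dots> \<le> (\<Sum>n. ennreal (c * r ^ n))"
  proof (rule suminf_le)
    fix n
    have "(\<Sum>j<2^n. \<integral>\<^sup>+\<omega>. ennreal (w n * \<bar>\<Delta> n j \<omega>\<bar> ^ m) \<partial>M)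
        \<le> (\<Sum>j<(2::nat)^n. ennreal (w n * (c * (1 / 2 ^ n) powr (1 + \<delta>))))"
    proof (rule sum_mono)
      fix j :: nat assume "j \<in> {..<2 ^ n}"
      then have j: "j < 2 ^ n" by simp
      have "(\<integral>\<^sup>+\<omega>. ennreal (w n * \<bar>\<Delta> n j \<omega>\<bar> ^ m) \<partial>M)
          = ennreal (w n) * (\<integral>\<^sup>+\<omega>. ennreal (\<bar>\<Delta> n j \<omega>\<bar> ^ m) \<partial>M)"
        using \<Delta>_meas[OF j] by (subst nn_integral_cmult[symmetric]) (auto simp: ennreal_mult w_def)
      also have "\<dots> \<le> ennreal (w n) *
          ennreal (c * \<bar>real (Suc j) / 2 ^ n - real j / 2 ^ n\<bar> powr (1 + \<delta>))"
        unfolding \<Delta>_def by (intro mult_left_mono moment grid[OF j]) auto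
      also have "\<bar>real (Suc j) / 2 ^ n - real j / 2 ^ n\<bar> = 1 / 2 ^ n"
        by (simp add: diff_divide_distrib[symmetric])
      also have "ennreal (w n) * ennreal (c * (1 / 2 ^ n) powr (1 + \<delta>))
          = ennreal (w n * (c * (1 / 2 ^ n) powr (1 + \<delta>)))"
        using c by (subst ennreal_mult) (auto simp: w_def)
      finally show "(\<integral>\<^sup>+\<omega>. ennreal (w n * \<bar>\<Delta> n j \<omega>\<bar> ^ m) \<partial>M)
        \<le> ennreal (w n * (c * (1 / 2 ^ n) powr (1 + \<delta>)))" .
    qed
    also have "\<dots> = ennreal (\<Sum>j<(2::nat)^n. w n * (c * (1 / 2 ^ n) powr (1 + \<delta>)))"
      using c by (intro sum_ennreal) (auto simp: w_def)
    also have "(\<Sum>j<(2::nat)^n. w n * (c * (1 / 2 ^ n) powr (1 + \<delta>))) = c * r ^ n"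
    proof -
      have "2 ^ n * (w n * (1 / 2 ^ n) powr (1 + \<delta>)) = r ^ n"
      proof -
        have "2 ^ n * (w n * (1 / 2 ^ n) powr (1 + \<delta>))
            = 2 powr n * (2 powr (\<beta> * (n * m)) * 2 powr (- real n * (1 + \<delta>)))"
        proof -
          have "1 / 2 ^ n = 2 powr (- real n)" by (simp add: powr_minus powr_realpow divide_inverse)
          then have "(1 / 2 ^ n) powr (1 + \<delta>) = 2 powr (- real n * (1 + \<delta>))" by (simp add: powr_powr)
          then show ?thesis by (simp add: w_def powr_realpow[symmetric] powr_powr)
        qed
        also have "\<dots> = 2 powr ((m * \<beta> - \<delta>) * n)"
          unfolding powr_add[symmetric] by (rule arg_cong[where f = "(powr) 2"]) (simp add: algebra_simps)
        also have "\<dots> = r ^ n"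
          using r by (simp add: r_def powr_realpow[symmetric] powr_powr)
        finally show ?thesis .
      qed
      then show ?thesis by (simp add: mult_ac)
    qed
    finally show "(\<Sum>j<2^n. \<integral>\<^sup>+\<omega>. ennreal (w n * \<bar>\<Delta> n j \<omega>\<bar> ^ m) \<partial>M) \<le> ennreal (c * r ^ n)" .
  qed auto
  also have "\<dots> < \<infinity>"
  proof -
    have "summable (\<lambda>n. c * r ^ n)" using r by (intro summable_mult summable_geometric) auto
    then show ?thesis using c r by (subst suminf_ennreal2) auto
  qed
  finally have S_fin: "(\<integral>\<^sup>+\<omega>. S \<omega> \<partial>M) < \<infinity>" .
  define C where "C = 2 powr \<beta> * (2 / (1 - 2 powr - \<beta>) + 1)"
  have C: "0 \<le> C"
  proof -
    have "2 powr - \<beta> < (1::real)" using \<beta> by (simp add: powr_less_one)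
    then show ?thesis by (simp add: C_def)
  qed
  \<comment> \<open>\<open>enn2real\<close> sends infinity to 0, so \<open>K\<close> is finite
    everywhere and its bound can fail only on the null set where \<open>S\<close> is
    infinite.\<close>
  define K where "K \<omega> = C * root m (enn2real (S \<omega>))" for \<omega>
  have S_AE: "AE \<omega> in M. S \<omega> \<noteq> \<infinity>"
    by (rule nn_integral_PInf_AE) (use S_fin in auto)
  show ?thesis
  proof (rule that)
    show "K \<in> borel_measurable M"
      unfolding K_def by measurable
    show "0 \<le> K \<omega>" for \<omega> using C m by (simp add: K_def)
    have "integrable M (\<lambda>\<omega>. enn2real (S \<omega>))"
    proof (rule integrableI_bounded)
      have "(\<integral>\<^sup>+ \<omega>. ennreal (norm (enn2real (S \<omega>))) \<partial>M) = (\<integral>\<^sup>+\<omega>. S \<omega> \<partial>M)"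
        by (rule nn_integral_cong_AE) (use S_AE in \<open>auto simp: less_top\<close>)
      with S_fin show "(\<integral>\<^sup>+ \<omega>. ennreal (norm (enn2real (S \<omega>))) \<partial>M) < \<infinity>" by simp
    qed measurable
    then show "integrable M (\<lambda>\<omega>. K \<omega> ^ m)"
      using m by (simp add: K_def power_mult_distrib)
    show "AE \<omega> in M. \<forall>s\<in>{0..1}. \<forall>t\<in>{0..1}. \<bar>Z t \<omega> - Z s \<omega>\<bar> \<le> K \<omega> * \<bar>t - s\<bar> powr \<beta>"
      using S_AE AE_space
    proof eventually_elim
      fix \<omega> assume fin: "S \<omega> \<noteq> \<infinity>" and \<omega>: "\<omega> \<in> space M"
      have incr: "\<bar>Z (real (Suc j) / 2 ^ n) \<omega> - Z (real j / 2 ^ n) \<omega>\<bar>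
          \<le> root m (enn2real (S \<omega>)) * (2 powr - \<beta>) ^ n" if j: "j < 2 ^ n" for n j
      proof -
        have "ennreal (w n * \<bar>\<Delta> n j \<omega>\<bar> ^ m) \<le> (\<Sum>j<2^n. ennreal (w n * \<bar>\<Delta> n j \<omega>\<bar> ^ m))"
          by (rule member_le_sum) (use j in auto)
        also have "\<dots> = (\<Sum>n\<in>{n}. \<Sum>j<2^n. ennreal (w n * \<bar>\<Delta> n j \<omega>\<bar> ^ m))" by simp
        also have "\<dots> \<le> S \<omega>"
          unfolding S_def by (rule sum_le_suminf) auto
        also have "S \<omega> = ennreal (enn2real (S \<omega>))" using fin by (simp add: less_top)
        finally have "w n * \<bar>\<Delta> n j \<omega>\<bar> ^ m \<le> enn2real (S \<omega>)" by simp
        then have "((2 powr \<beta>) ^ n * \<bar>\<Delta> n j \<omega>\<bar>) ^ m \<le> enn2real (S \<omega>)"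
          by (simp add: w_def power_mult_distrib power_mult)
        then have "root m (((2 powr \<beta>) ^ n * \<bar>\<Delta> n j \<omega>\<bar>) ^ m) \<le> root m (enn2real (S \<omega>))"
          using m by simp
        then have "(2 powr \<beta>) ^ n * \<bar>\<Delta> n j \<omega>\<bar> \<le> root m (enn2real (S \<omega>))"
          using m by (simp add: real_root_power_cancel)
        then show ?thesis
          by (simp add: \<Delta>_def powr_minus field_simps)
      qed
      show "\<forall>s\<in>{0..1}. \<forall>t\<in>{0..1}. \<bar>Z t \<omega> - Z s \<omega>\<bar> \<le> K \<omega> * \<bar>t - s\<bar> powr \<beta>"
        using dyadic_increments_hoelder[OF cont[OF \<omega>] \<beta> _ incr] m
        unfolding K_def C_def by auto
    qed
  qed
qed

section \<open>Moments and Hoelder constants of fractional Brownian motion\<close>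

context prob_space
begin

text \<open>The covariance formula alone does not give integrability, because the integral of a
  non-integrable function is 0 by convention; Gaussianity supplies it.\<close>

lemma gaussian_rv_square_integrable:
  assumes "gaussian_rv M Z"
  shows "integrable M (\<lambda>\<omega>. (Z \<omega>)\<^sup>2)"
proof -
  have meas [measurable]: "Z \<in> borel_measurable M" using assms by (simp add: gaussian_rv_def)
  consider \<mu> \<sigma> where "0 < \<sigma>" "distributed M lborel Z (normal_density \<mu> \<sigma>)"
    | \<mu> where "AE \<omega> in M. Z \<omega> = \<mu>"
    using assms by (auto simp: gaussian_rv_def)
  then show ?thesis
  proof cases
    case 1
    \<comment> \<open>Expansion of the square of \<open>x\<close> around the mean, each term being a
      known normal moment.\<close>
    have "integrable lborel (\<lambda>x. normal_density \<mu> \<sigma> x * (x - \<mu>)\<^sup>2 + 2 * \<mu> * (normal_density \<mu> \<sigma> x * x)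
        - \<mu>\<^sup>2 * normal_density \<mu> \<sigma> x)"
      by (intro Bochner_Integration.integrable_diff Bochner_Integration.integrable_add
          integrable_mult_right integrable_normal_moment integrable_normal_moment_nz_1
          integrable_normal_density 1)
    then have "integrable lborel (\<lambda>x. normal_density \<mu> \<sigma> x * x\<^sup>2)"
      by (rule Bochner_Integration.integrable_cong[THEN iffD1, rotated 2])
        (auto simp: power2_eq_square algebra_simps)
    then show ?thesis
      by (subst (asm) distributed_integrable[OF 1(2)]) auto
  next
    case 2
    have "integrable M (\<lambda>\<omega>. \<mu>\<^sup>2)" by simp
    then show ?thesis
      by (rule integrable_cong_AE_imp) (use 2 in auto)
  qed
qed

text \<open>The numerical factor is the double factorial of \<open>2 * k - 1\<close>. For a proper
  normal law the moment is exact; a Dirac law with mean 0 sits at 0, and its moment vanishes since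
  \<open>k > 0\<close>.\<close>

lemma gaussian_rv_even_moment:
  assumes "gaussian_rv M Z" and mean: "expectation Z = 0" and k: "0 < k"
  shows "(\<integral>\<^sup>+\<omega>. ennreal (\<bar>Z \<omega>\<bar> ^ (2 * k)) \<partial>M)
    \<le> ennreal (fact (2 * k) / (2 ^ k * fact k) * (expectation (\<lambda>\<omega>. (Z \<omega>)\<^sup>2)) ^ k)"
proof -
  have meas [measurable]: "Z \<in> borel_measurable M" using assms by (simp add: gaussian_rv_def)
  consider \<mu> \<sigma> where "0 < \<sigma>" "distributed M lborel Z (normal_density \<mu> \<sigma>)"
    | \<mu> where "AE \<omega> in M. Z \<omega> = \<mu>"
    using assms by (auto simp: gaussian_rv_def)
  then show ?thesis
  proof cases
    case 1
    have "\<mu> = 0" using normal_distributed_expectation[OF 1] mean by simp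
    then have var: "expectation (\<lambda>\<omega>. (Z \<omega>)\<^sup>2) = \<sigma>\<^sup>2"
      using normal_distributed_variance[OF 1] mean by simp
    have "(\<integral>\<^sup>+\<omega>. ennreal (\<bar>Z \<omega>\<bar> ^ (2 * k)) \<partial>M)
        = (\<integral>\<^sup>+x. ennreal (normal_density \<mu> \<sigma> x) * ennreal (\<bar>x\<bar> ^ (2 * k)) \<partial>lborel)"
      by (rule distributed_nn_integral[OF 1(2), symmetric]) auto
    also have "\<dots> = (\<integral>\<^sup>+x. ennreal (normal_density 0 \<sigma> x * (x - 0) ^ (2 * k)) \<partial>lborel)"
      using \<open>\<mu> = 0\<close> by (intro nn_integral_cong) (auto simp: ennreal_mult power_even_abs)
    also have "\<dots> = ennreal (fact (2 * k) / ((2 / \<sigma>\<^sup>2) ^ k * fact k))"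
      by (subst nn_integral_eq_integral)
        (use 1 integrable_normal_moment[of \<sigma> 0 "2 * k"] integral_normal_moment_even[of \<sigma> 0 k] in auto)
    also have "fact (2 * k) / ((2 / \<sigma>\<^sup>2) ^ k * fact k) = fact (2 * k) / (2 ^ k * fact k) * (\<sigma>\<^sup>2) ^ k"
      using 1 by (simp add: power_divide field_simps)
    finally show ?thesis by (simp add: var)
  next
    case 2
    have "expectation Z = \<mu>"
      using integral_cong_AE[of Z M "\<lambda>_. \<mu>"] 2 by (simp add: prob_space)
    with 2 mean have "AE \<omega> in M. Z \<omega> = 0" by simp
    then have "(\<integral>\<^sup>+\<omega>. ennreal (\<bar>Z \<omega>\<bar> ^ (2 * k)) \<partial>M) = (\<integral>\<^sup>+\<omega>. 0 \<partial>M)"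
      by (intro nn_integral_cong_AE) (use k in auto)
    then show ?thesis by simp
  qed
qed

lemma fbm_mean:
  assumes "fractional_brownian_motion M H B" "0 \<le> t"
  shows "expectation (B t) = 0"
  using assms by (auto simp: fractional_brownian_motion_def)

lemma fbm_covariance:
  assumes "fractional_brownian_motion M H B" "0 \<le> s" "0 \<le> t"
  shows "expectation (\<lambda>\<omega>. B t \<omega> * B s \<omega>)
    = (t powr (2 * H) + s powr (2 * H) - \<bar>t - s\<bar> powr (2 * H)) / 2"
  using assms unfolding fractional_brownian_motion_def by blast

text \<open>The sums in \<open>gaussian_process\<close> range over a set of times, in which equal
  times would merge into one term; hence \<open>s \<noteq> t\<close>.\<close>

lemma fbm_gaussian_combination:
  assumes "fractional_brownian_motion M H B" "0 \<le> s" "0 \<le> t" "s \<noteq> t"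
  shows "gaussian_rv M (\<lambda>\<omega>. a * B s \<omega> + b * B t \<omega>)"
proof -
  have "gaussian_process M B" using assms(1) by (simp only: fractional_brownian_motion_def)
  moreover have "finite {s, t} \<and> {s, t} \<subseteq> {0..}" using assms by auto
  ultimately have "\<forall>c. gaussian_rv M (\<lambda>\<omega>. \<Sum>u\<in>{s, t}. c u * B u \<omega>)"
    unfolding gaussian_process_def by blast
  then have "gaussian_rv M (\<lambda>\<omega>. \<Sum>u\<in>{s, t}. (if u = s then a else b) * B u \<omega>)"
    by (rule allE)
  with \<open>s \<noteq> t\<close> show ?thesis by simp
qed

lemma fbm_gaussian:
  assumes "fractional_brownian_motion M H B" "0 \<le> t"
  shows "gaussian_rv M (B t)"
  using fbm_gaussian_combination[OF assms(1), of t "t + 1" 1 0] assms(2) by simp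

lemma fbm_measurable:
  assumes "fractional_brownian_motion M H B" "0 \<le> t"
  shows "B t \<in> borel_measurable M"
  using fbm_gaussian[OF assms] by (simp add: gaussian_rv_def)

text \<open>The covariance formula gives variance 0 at time 0, as
  \<open>0 powr (2 * H) = 0\<close>.\<close>

lemma fbm_AE_zero:
  assumes fbm: "fractional_brownian_motion M H B"
  shows "AE \<omega> in M. B 0 \<omega> = 0"
proof -
  have "expectation (\<lambda>\<omega>. (B 0 \<omega>)\<^sup>2) = 0"
    using fbm_covariance[OF fbm, of 0 0] by (simp add: power2_eq_square)
  then have "AE \<omega> in M. (B 0 \<omega>)\<^sup>2 = 0"
    by (subst (asm) integral_nonneg_eq_0_iff_AE)
      (use gaussian_rv_square_integrable[OF fbm_gaussian[OF fbm]] in auto)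
  then show ?thesis by simp
qed

text \<open>Increments are centred Gaussian, and expanding the square reduces their variance to
  \<open>\<bar>t - s\<bar> powr (2 * H)\<close>.\<close>

lemma fbm_increment_moment:
  assumes fbm: "fractional_brownian_motion M H B" and st: "0 \<le> s" "0 \<le> t" and k: "0 < k"
  shows "(\<integral>\<^sup>+\<omega>. ennreal (\<bar>B t \<omega> - B s \<omega>\<bar> ^ (2 * k)) \<partial>M)
    \<le> ennreal (fact (2 * k) / (2 ^ k * fact k) * \<bar>t - s\<bar> powr (2 * H * k))"
proof (cases "s = t")
  case True
  with k show ?thesis by simp
next
  case False
  let ?Z = "\<lambda>\<omega>. B t \<omega> - B s \<omega>"
  note meas [measurable] = fbm_measurable[OF fbm st(1)] fbm_measurable[OF fbm st(2)]
  have gauss: "gaussian_rv M ?Z"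
    using fbm_gaussian_combination[OF fbm st False, of "-1" 1] by simp
  have sq: "integrable M (\<lambda>\<omega>. B s \<omega> * B s \<omega>)" "integrable M (\<lambda>\<omega>. B t \<omega> * B t \<omega>)"
    using gaussian_rv_square_integrable[OF fbm_gaussian[OF fbm]] st
    by (auto simp: power2_eq_square)
  \<comment> \<open>The product is dominated by the sum of the squares.\<close>
  have prod: "integrable M (\<lambda>\<omega>. B t \<omega> * B s \<omega>)"
  proof (rule Bochner_Integration.integrable_bound[OF Bochner_Integration.integrable_add[OF sq]])
    have "\<bar>x * y\<bar> \<le> \<bar>y * y + x * x\<bar>" for x y :: real
    proof -
      have "2 * \<bar>x * y\<bar> \<le> y * y + x * x"
        using sum_squares_bound[of "\<bar>x\<bar>" "\<bar>y\<bar>"] by (simp add: abs_mult power2_eq_square)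
      then show ?thesis by linarith
    qed
    then show "AE \<omega> in M. norm (B t \<omega> * B s \<omega>) \<le> norm (B s \<omega> * B s \<omega> + B t \<omega> * B t \<omega>)" by simp
  qed measurable
  have lin: "integrable M (B s)" "integrable M (B t)"
    using square_integrable_imp_integrable[of "B s"] square_integrable_imp_integrable[of "B t"]
      sq by (auto simp: power2_eq_square)
  have mean: "expectation ?Z = 0"
    using fbm_mean[OF fbm] st lin by simp
  have "expectation (\<lambda>\<omega>. (?Z \<omega>)\<^sup>2)
      = expectation (\<lambda>\<omega>. B t \<omega> * B t \<omega> - 2 * (B t \<omega> * B s \<omega>) + B s \<omega> * B s \<omega>)"
    by (rule Bochner_Integration.integral_cong) (auto simp: power2_eq_square algebra_simps)
  also have "\<dots> = \<bar>t - s\<bar> powr (2 * H)"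
    using sq prod by (simp add: fbm_covariance[OF fbm] st diff_divide_distrib add_divide_distrib)
  finally have var: "expectation (\<lambda>\<omega>. (?Z \<omega>)\<^sup>2) = \<bar>t - s\<bar> powr (2 * H)" .
  have "(\<bar>t - s\<bar> powr (2 * H)) ^ k = \<bar>t - s\<bar> powr (2 * H * k)"
    using False by (simp add: powr_realpow[symmetric] powr_powr)
  with gaussian_rv_even_moment[OF gauss mean k] var show ?thesis by simp
qed

text \<open>Rescaling time by \<open>T\<close> reduces to the unit interval. The moment of order
  \<open>2 * k\<close> has exponent \<open>2 * H * k = 1 + \<delta>\<close>, so the condition
  \<open>2 * k * \<beta> < \<delta>\<close> is exactly the hypothesis on \<open>k\<close>. Undoing
  the scaling costs \<open>T powr - \<beta>\<close>.\<close>

lemma fbm_hoelder: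
  assumes fbm: "fractional_brownian_motion M H B" and \<beta>: "0 < \<beta>" and T: "0 < T"
    and k: "1 < 2 * real k * (H - \<beta>)"
  obtains K where "K \<in> borel_measurable M" "\<And>\<omega>. 0 \<le> K \<omega>" "integrable M (\<lambda>\<omega>. K \<omega> ^ (2 * k))"
    "AE \<omega> in M. \<forall>s\<in>{0..T}. \<forall>t\<in>{0..T}. \<bar>B t \<omega> - B s \<omega>\<bar> \<le> K \<omega> * \<bar>t - s\<bar> powr \<beta>"
proof -
  have k0: "0 < k" using k by (cases k) auto
  define c where "c = fact (2 * k) / (2 ^ k * fact k) * T powr (2 * H * k)"
  define \<delta> where "\<delta> = 2 * H * k - 1"
  have c: "0 \<le> c" by (simp add: c_def)
  have \<delta>: "real (2 * k) * \<beta> < \<delta>" using k by (simp add: \<delta>_def algebra_simps)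
  have moment: "(\<integral>\<^sup>+\<omega>. ennreal (\<bar>B (T * t) \<omega> - B (T * s) \<omega>\<bar> ^ (2 * k)) \<partial>M)
      \<le> ennreal (c * \<bar>t - s\<bar> powr (1 + \<delta>))" if "s \<in> {0..1}" "t \<in> {0..1}" for s t
  proof -
    have "\<bar>T * t - T * s\<bar> = T * \<bar>t - s\<bar>"
      using T by (simp add: right_diff_distrib[symmetric] abs_mult)
    then have "\<bar>T * t - T * s\<bar> powr (2 * H * k) = T powr (2 * H * k) * \<bar>t - s\<bar> powr (1 + \<delta>)"
      using T by (simp add: powr_mult \<delta>_def)
    with fbm_increment_moment[OF fbm, of "T * s" "T * t" k] k0 that T show ?thesis
      by (simp add: c_def mult.assoc)
  qed
  have cont: "continuous_on {0..1} (\<lambda>t. B (T * t) \<omega>)" if "\<omega> \<in> space M" for \<omega>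
  proof (rule continuous_on_compose2[where g = "\<lambda>t. B t \<omega>"])
    show "continuous_on {0..} (\<lambda>t. B t \<omega>)"
      using fbm that by (simp add: fractional_brownian_motion_def continuous_paths_def)
  qed (use T in \<open>auto intro!: continuous_intros\<close>)
  have meas: "B (T * t) \<in> borel_measurable M" if "t \<in> {0..1}" for t
    by (rule fbm_measurable[OF fbm]) (use that T in auto)
  have "0 < 2 * k" using k0 by simp
  from kolmogorov_hoelder[where Z = "\<lambda>t. B (T * t)", OF this \<beta> c \<delta> meas cont moment]
  obtain K where K: "K \<in> borel_measurable M" "\<And>\<omega>. 0 \<le> K \<omega>" "integrable M (\<lambda>\<omega>. K \<omega> ^ (2 * k))"
    and hoelder: "AE \<omega> in M. \<forall>s\<in>{0..1}. \<forall>t\<in>{0..1}. \<bar>B (T * t) \<omega> - B (T * s) \<omega>\<bar> \<le> K \<omega> * \<bar>t - s\<bar> powr \<beta>"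
    by blast
  show ?thesis
  proof (rule that[of "\<lambda>\<omega>. T powr - \<beta> * K \<omega>"])
    show "integrable M (\<lambda>\<omega>. (T powr - \<beta> * K \<omega>) ^ (2 * k))"
      using K(3) by (simp add: power_mult_distrib)
    show "AE \<omega> in M. \<forall>s\<in>{0..T}. \<forall>t\<in>{0..T}. \<bar>B t \<omega> - B s \<omega>\<bar> \<le> T powr - \<beta> * K \<omega> * \<bar>t - s\<bar> powr \<beta>"
      using hoelder
    proof eventually_elim
      fix \<omega> assume h: "\<forall>s\<in>{0..1}. \<forall>t\<in>{0..1}. \<bar>B (T * t) \<omega> - B (T * s) \<omega>\<bar> \<le> K \<omega> * \<bar>t - s\<bar> powr \<beta>"
      show "\<forall>s\<in>{0..T}. \<forall>t\<in>{0..T}. \<bar>B t \<omega> - B s \<omega>\<bar> \<le> T powr - \<beta> * K \<omega> * \<bar>t - s\<bar> powr \<beta>"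
      proof (intro ballI)
        fix s t assume st: "s \<in> {0..T}" "t \<in> {0..T}"
        have "\<bar>B (T * (t / T)) \<omega> - B (T * (s / T)) \<omega>\<bar> \<le> K \<omega> * \<bar>t / T - s / T\<bar> powr \<beta>"
          using st T by (intro h[rule_format]) auto
        also have "\<bar>t / T - s / T\<bar> = \<bar>t - s\<bar> / T"
          using T by (simp add: diff_divide_distrib[symmetric])
        also have "(\<bar>t - s\<bar> / T) powr \<beta> = T powr - \<beta> * \<bar>t - s\<bar> powr \<beta>"
          using T by (simp add: powr_divide powr_minus_divide)
        finally show "\<bar>B t \<omega> - B s \<omega>\<bar> \<le> T powr - \<beta> * K \<omega> * \<bar>t - s\<bar> powr \<beta>"
          using T by (simp add: mult_ac)
      qed
    qed
  qed (use K in auto)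
qed

end

text \<open>By continuity the supremum may be taken over a countable dense set of times.\<close>

lemma sup_norm_measurable:
  assumes T: "0 \<le> T"
    and meas: "\<And>t. t \<in> {0..T} \<Longrightarrow> Z t \<in> borel_measurable M"
    and cont: "\<And>\<omega>. \<omega> \<in> space M \<Longrightarrow> continuous_on {0..T} (\<lambda>t. Z t \<omega>)"
  shows "(\<lambda>\<omega>. sup_norm T (\<lambda>t. Z t \<omega>)) \<in> borel_measurable M"
proof -
  obtain D :: "real set" where D: "countable D" "D \<subseteq> {0..T}" "{0..T} \<subseteq> closure D"
    using separable by metis
  have "closure D \<subseteq> {0..T}" using D(2) by (intro closure_minimal) auto
  with D have closure: "closure D = {0..T}" by auto
  have "D \<noteq> {}" using closure T by auto
  have bdd: "bdd_above ((\<lambda>t. \<bar>Z t \<omega>\<bar>) ` {0..T})" if "\<omega> \<in> space M" for \<omega>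
    by (intro bounded_imp_bdd_above compact_imp_bounded compact_continuous_image
        continuous_intros cont that) auto
  have bddD: "bdd_above ((\<lambda>t. \<bar>Z t \<omega>\<bar>) ` D)" if "\<omega> \<in> space M" for \<omega>
    using bdd[OF that] by (rule bdd_above_mono) (use D in auto)
  have "sup_norm T (\<lambda>t. Z t \<omega>) = (SUP t\<in>D. \<bar>Z t \<omega>\<bar>)" if \<omega>: "\<omega> \<in> space M" for \<omega>
    unfolding sup_norm_def
  proof (rule antisym)
    show "(SUP t\<in>D. \<bar>Z t \<omega>\<bar>) \<le> (SUP t\<in>{0..T}. \<bar>Z t \<omega>\<bar>)"
      using D \<open>D \<noteq> {}\<close> bdd[OF \<omega>] by (intro cSUP_subset_mono) auto
    show "(SUP t\<in>{0..T}. \<bar>Z t \<omega>\<bar>) \<le> (SUP t\<in>D. \<bar>Z t \<omega>\<bar>)"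
    proof (rule cSUP_least)
      fix t assume t: "t \<in> {0..T}"
      show "\<bar>Z t \<omega>\<bar> \<le> (SUP t\<in>D. \<bar>Z t \<omega>\<bar>)"
      proof (rule continuous_le_on_closure[where S = D and f = "\<lambda>t. \<bar>Z t \<omega>\<bar>"])
        show "continuous_on (closure D) (\<lambda>t. \<bar>Z t \<omega>\<bar>)"
          unfolding closure by (intro continuous_intros cont \<omega>)
      qed (use t closure bddD[OF \<omega>] in \<open>auto intro: cSUP_upper\<close>)
    qed (use T in auto)
  qed
  moreover have "(\<lambda>\<omega>. SUP t\<in>D. \<bar>Z t \<omega>\<bar>) \<in> borel_measurable M"
    by (rule borel_measurable_cSUP) (use D meas bddD in auto)
  ultimately show ?thesis by (simp cong: measurable_cong)
qed

section \<open>The singular equation\<close>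

text \<open>Using \<open>Suc n\<close> makes the clamping interval nonempty and positive for every
  \<open>n\<close>, so \<open>f\<close> is evaluated only where the assumptions speak about
  it.\<close>

definition truncated_drift :: "(real \<Rightarrow> real \<Rightarrow> real) \<Rightarrow> nat \<Rightarrow> real \<Rightarrow> real \<Rightarrow> real" where
  "truncated_drift f n t x = f t (max (1 / real (Suc n)) (min x (real (Suc n))))"

text \<open>An explicit limit rather than a chosen solution, so that it depends measurably on the
  path.\<close>

definition truncated_solution ::
    "(real \<Rightarrow> real \<Rightarrow> real) \<Rightarrow> real \<Rightarrow> (real \<Rightarrow> real) \<Rightarrow> nat \<Rightarrow> real \<Rightarrow> real" where
  "truncated_solution f x0 \<phi> n t = lim (\<lambda>k. picard (truncated_drift f n) (\<lambda>s. x0 + \<phi> s) k t)"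

lemma assumption_i_DERIV:
  assumes "assumption_i f" "0 \<le> t" "0 < x"
  shows "(f t has_field_derivative deriv (f t) x) (at x)"
proof -
  have "f t field_differentiable (at x)" using assms unfolding assumption_i_def by blast
  then show ?thesis by (simp add: DERIV_deriv_iff_field_differentiable)
qed

text \<open>Clamped values stay in a compact subset of the positive half-line, on which the space
  derivative is bounded for times up to \<open>T\<close>; the clamp itself is 1-Lipschitz.\<close>

lemma truncated_lipschitz_drift:
  assumes f: "assumption_i f"
  shows "lipschitz_drift (truncated_drift f n)"
proof
  define a b where "a = 1 / real (Suc n)" and "b = real (Suc n)"
  have "a \<le> 1" "1 \<le> b" by (simp_all add: a_def b_def)
  then have "a \<le> b" by linarith
  moreover have "0 < a" by (simp add: a_def)
  ultimately have ab: "0 < a" "a \<le> b" by auto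
  define clamp where "clamp x = max a (min x b)" for x
  have clamp: "clamp x \<in> {a..b}" for x using ab by (auto simp: clamp_def)
  have drift: "truncated_drift f n t x = f t (clamp x)" for t x
    by (simp add: truncated_drift_def clamp_def a_def b_def)
  have "continuous_on ({0..} \<times> UNIV) (\<lambda>p. (\<lambda>(t, x). f t x) (fst p, clamp (snd p)))"
  proof (rule continuous_on_compose2[where g = "\<lambda>(t, x). f t x"])
    show "continuous_on ({0..} \<times> {0<..}) (\<lambda>(t, x). f t x)"
      using f by (simp add: assumption_i_def)
    show "continuous_on ({0..} \<times> UNIV) (\<lambda>p. (fst p, clamp (snd p)))"
      unfolding clamp_def by (intro continuous_intros)
    show "(\<lambda>p. (fst p, clamp (snd p))) ` ({0..} \<times> UNIV) \<subseteq> {0..} \<times> {0<..}"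
      using clamp ab by (auto intro: less_le_trans)
  qed
  then show "continuous_on ({0..} \<times> UNIV) (\<lambda>(t, x). truncated_drift f n t x)"
    by (simp add: drift case_prod_beta)
  fix T :: real
  have "compact ((\<lambda>(t, x). deriv (f t) x) ` ({0..T} \<times> {a..b}))"
    using f ab unfolding assumption_i_def
    by (intro compact_continuous_image compact_Times compact_Icc) (auto elim!: continuous_on_subset)
  from compact_imp_bounded[OF this] obtain L where
    "\<forall>y \<in> (\<lambda>(t, x). deriv (f t) x) ` ({0..T} \<times> {a..b}). norm y \<le> L"
    unfolding bounded_iff by blast
  then have L: "norm (deriv (f t) x) \<le> L" if "t \<in> {0..T}" "x \<in> {a..b}" for t x
    using that by force
  show "\<exists>L. \<forall>t\<in>{0..T}. \<forall>x y. \<bar>truncated_drift f n t x - truncated_drift f n t y\<bar> \<le> L * \<bar>x - y\<bar>"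
  proof (intro exI[of _ L] ballI allI)
    fix t x y assume t: "t \<in> {0..T}"
    have "norm (f t (clamp x) - f t (clamp y)) \<le> L * norm (clamp x - clamp y)"
    proof (rule field_differentiable_bound[where S = "{a..b}" and f' = "deriv (f t)"])
      show "(f t has_field_derivative deriv (f t) z) (at z within {a..b})" if "z \<in> {a..b}" for z
        by (rule has_field_derivative_at_within[OF assumption_i_DERIV[OF f]]) (use t that ab in auto)
    qed (use clamp L[OF t] in auto)
    also have "\<dots> \<le> L * \<bar>x - y\<bar>"
      using order_trans[OF norm_ge_zero L[OF t clamp]]
      by (intro mult_left_mono) (auto simp: clamp_def)
    finally show "\<bar>truncated_drift f n t x - truncated_drift f n t y\<bar> \<le> L * \<bar>x - y\<bar>"
      by (simp add: drift)
  qed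
qed

lemma assumption_i_antimono:
  assumes "assumption_i f" "0 < s" "0 < x" "x \<le> y"
  shows "f s y \<le> f s x"
proof (rule DERIV_nonpos_imp_nonincreasing[OF \<open>x \<le> y\<close>])
  fix z assume "x \<le> z"
  then show "\<exists>d. (f s has_field_derivative d) (at z) \<and> d \<le> 0"
    using assms assumption_i_DERIV[OF assms(1), of s z]
    by (intro exI[of _ "deriv (f s) z"]) (auto simp: assumption_i_def)
qed

lemma assumption_i_continuous_along:
  assumes "assumption_i f" "continuous_on A u" "A \<subseteq> {0..}" "\<And>s. s \<in> A \<Longrightarrow> 0 < u s"
  shows "continuous_on A (\<lambda>s. f s (u s))"
proof -
  have "continuous_on A (\<lambda>s. (\<lambda>(t, x). f t x) (s, u s))"
  proof (rule continuous_on_compose2[where g = "\<lambda>(t, x). f t x"])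
    show "continuous_on ({0..} \<times> {0<..}) (\<lambda>(t, x). f t x)"
      using assms(1) by (simp add: assumption_i_def)
  qed (use assms in \<open>auto intro!: continuous_intros\<close>)
  then show ?thesis by simp
qed

section \<open>Uniqueness, bounds and construction of positive solutions along a single path\<close>

lemma positive_solution_unique:
  assumes f: "assumption_i f"
    and u: "\<And>t. 0 \<le> t \<Longrightarrow> (\<lambda>s. f s (u s)) integrable_on {0..t} \<and> u t = c + integral {0..t} (\<lambda>s. f s (u s)) + \<phi> t"
      "continuous_on {0..} u" "\<And>t. 0 \<le> t \<Longrightarrow> 0 < u t"
    and v: "\<And>t. 0 \<le> t \<Longrightarrow> (\<lambda>s. f s (v s)) integrable_on {0..t} \<and> v t = c + integral {0..t} (\<lambda>s. f s (v s)) + \<phi> t"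
      "continuous_on {0..} v" "\<And>t. 0 \<le> t \<Longrightarrow> 0 < v t"
    and t: "0 \<le> t"
  shows "u t = v t"
proof (rule monotone_drift_unique[where S = "{0<..}" and G = f and T = t
      and u = u and v = v and c = c and \<phi> = \<phi>])
  show "f s y \<le> f s x" if "0 < s" "x \<in> {0<..}" "y \<in> {0<..}" "x \<le> y" for s x y
    using assumption_i_antimono[OF f] that by auto
  show "continuous_on {0..t} u" "continuous_on {0..t} v"
    by (auto intro: continuous_on_subset[OF u(2)] continuous_on_subset[OF v(2)])
qed (use u v t in auto)

text \<open>Here \<open>\<beta>\<close> is the Hoelder exponent of the driving path, and
  \<open>\<alpha>\<beta>\<close> says that the singularity is strong enough for paths of this
  regularity.\<close>

locale singular_drift =
  fixes f :: "real \<Rightarrow> real \<Rightarrow> real" and x0 x1 \<alpha> \<beta> :: real and g h :: "real \<Rightarrow> real"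
  assumes f: "assumption_i f" and x0: "0 < x0" and x1: "0 < x1"
    and \<alpha>: "0 < \<alpha>" and \<beta>: "0 < \<beta>" and \<alpha>\<beta>: "1 < \<beta> * (\<alpha> + 1)"
    and g: "continuous_on {0..} g" "\<And>t. 0 < t \<Longrightarrow> 0 < g t"
    and lower: "\<And>t x. 0 \<le> t \<Longrightarrow> 0 < x \<Longrightarrow> x < x1 \<Longrightarrow> g t * x powr (- \<alpha>) \<le> f t x"
    and h: "\<And>t. 0 \<le> t \<Longrightarrow> 0 \<le> h t" "\<And>T. 0 \<le> T \<Longrightarrow> bounded (h ` {0..T})"
    and upper: "\<And>t x. 0 \<le> t \<Longrightarrow> 0 < x \<Longrightarrow> f t x \<le> h t * (1 + 1 / x)"
begin

text \<open>Above \<open>x0\<close> the singular factor in \<open>upper\<close> is at most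
  \<open>1 + 1 / x0\<close>, and \<open>h\<close> is bounded on compact intervals.\<close>

lemma drift_bound_above:
  assumes "0 \<le> T"
  obtains K where "0 \<le> K" "\<And>t x. t \<in> {0..T} \<Longrightarrow> x0 \<le> x \<Longrightarrow> f t x \<le> K"
proof -
  obtain b where "\<forall>y\<in>h ` {0..T}. norm y \<le> b"
    using h(2)[OF assms] unfolding bounded_iff by blast
  then have b: "h t \<le> b" if "t \<in> {0..T}" for t
    using that by (fastforce dest: bspec)
  show ?thesis
  proof (rule that)
    have "0 \<le> b" using b[of 0] h(1)[of 0] assms by auto
    then show "0 \<le> b * (1 + 1 / x0)" using x0 by simp
    fix t x assume t: "t \<in> {0..T}" and x: "x0 \<le> x"
    have "f t x \<le> h t * (1 + 1 / x)" using upper t x x0 by auto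
    also have "\<dots> \<le> b * (1 + 1 / x0)"
      using b[OF t] h(1)[of t] t x x0 \<open>0 \<le> b\<close> by (intro mult_mono add_left_mono divide_left_mono) auto
    finally show "f t x \<le> b * (1 + 1 / x0)" .
  qed
qed

lemma hoelder_oscillation:
  fixes \<phi> :: "real \<Rightarrow> real"
  assumes hoelder: "\<And>s t. s \<in> {0..T} \<Longrightarrow> t \<in> {0..T} \<Longrightarrow> \<bar>\<phi> t - \<phi> s\<bar> \<le> C * \<bar>t - s\<bar> powr \<beta>"
    and "0 \<le> C" "s \<in> {0..T}" "t \<in> {0..T}"
  shows "\<phi> t - \<phi> s \<le> C * T powr \<beta>"
proof -
  have "\<phi> t - \<phi> s \<le> C * \<bar>t - s\<bar> powr \<beta>" using hoelder[OF assms(3,4)] by linarith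
  also have "\<dots> \<le> C * T powr \<beta>" using assms \<beta> by (intro mult_left_mono powr_mono2) auto
  finally show ?thesis .
qed

text \<open>The bounds \<open>\<delta>\<close> and \<open>U\<close> do not depend on
  \<open>n\<close>. Once the clamping interval contains everything between them, the clamp is
  inactive along the solution, which then solves the original equation; monotonicity identifies all
  these solutions.\<close>

lemma truncated_solution_eventually_solves:
  fixes \<phi> :: "real \<Rightarrow> real"
  assumes \<phi>: "continuous_on {0..} \<phi>" "\<phi> 0 = 0" and C: "0 < C" and T: "0 < T"
    and hoelder: "\<And>s t. s \<in> {0..T} \<Longrightarrow> t \<in> {0..T} \<Longrightarrow> \<bar>\<phi> t - \<phi> s\<bar> \<le> C * \<bar>t - s\<bar> powr \<beta>"
  defines "y \<equiv> truncated_solution f x0 \<phi>"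
  obtains N where
    "\<And>t. t \<in> {0..T} \<Longrightarrow> 0 < y N t \<and> y N t = x0 + integral {0..t} (\<lambda>s. f s (y N s)) + \<phi> t"
    "continuous_on {0..T} (y N)"
    "\<And>n t. N \<le> n \<Longrightarrow> t \<in> {0..T} \<Longrightarrow> y n t = y N t"
proof -
  obtain K where K: "0 \<le> K" "\<And>t x. t \<in> {0..T} \<Longrightarrow> x0 \<le> x \<Longrightarrow> f t x \<le> K"
    using drift_bound_above[of T] T by auto
  define U where "U = x0 + K * T + C * T powr \<beta>"
  obtain \<delta> where \<delta>: "0 < \<delta>" and lower_bound:
    "\<And>y \<rho> \<phi> t. \<lbrakk>continuous_on {0..T} y; \<rho> integrable_on {0..T};
       \<And>t. t \<in> {0..T} \<Longrightarrow> y t = x0 + integral {0..t} \<rho> + \<phi> t;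
       \<phi> 0 = 0; \<And>s t. s \<in> {0..T} \<Longrightarrow> t \<in> {0..T} \<Longrightarrow> \<bar>\<phi> t - \<phi> s\<bar> \<le> C * \<bar>t - s\<bar> powr \<beta>;
       \<And>s. s \<in> {0..T} \<Longrightarrow> 0 \<le> \<rho> s;
       \<And>s. s \<in> {0..T} \<Longrightarrow> \<delta> \<le> y s \<Longrightarrow> y s < x1 \<Longrightarrow> g s * y s powr (-\<alpha>) \<le> \<rho> s;
       t \<in> {0..T}\<rbrakk> \<Longrightarrow> \<delta> < y t"
    using solution_lower_bound[OF T C \<beta> \<alpha> \<alpha>\<beta> x0 x1 g] by blast
  \<comment> \<open>Exceeding \<open>U\<close> and \<open>1 / \<delta>\<close> makes the clamp
    inactive between the two bounds. Exceeding \<open>x1\<close> does so where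
    \<open>\<delta> \<le> y n s < x1\<close>, before any upper bound is known; exceeding
    \<open>x0\<close> keeps clamped values above \<open>x0\<close> whenever \<open>y n s\<close>
    is.\<close>
  obtain N where N: "max U (max x1 (max x0 (max (1 / \<delta>) (1 / x0)))) < real N"
    using reals_Archimedean2 by blast
  have sol: "continuous_on {0..T} (y n)"
      "\<And>t. t \<in> {0..T} \<Longrightarrow> 0 < y n t"
      "(\<lambda>s. f s (y n s)) integrable_on {0..T}"
      "\<And>t. t \<in> {0..T} \<Longrightarrow> y n t = x0 + integral {0..t} (\<lambda>s. f s (y n s)) + \<phi> t"
    if n: "N \<le> n" for n
  proof -
    interpret lipschitz_drift "truncated_drift f n"
      by (rule truncated_lipschitz_drift[OF f])
    let ?\<rho> = "\<lambda>s. truncated_drift f n s (y n s)"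
    have n_large: "U < real (Suc n)" "x1 < real (Suc n)" "x0 < real (Suc n)"
        "1 / \<delta> < real (Suc n)" "1 / x0 < real (Suc n)"
      using N n by auto
    have n_small: "1 / real (Suc n) < \<delta>" "1 / real (Suc n) < x0"
      using n_large(4,5) \<delta> x0 by (simp_all add: field_simps)
    have x0\<phi>: "continuous_on {0..} (\<lambda>s. x0 + \<phi> s)" using \<phi>(1) by (intro continuous_intros)
    have cont': "continuous_on {0..} (y n)"
      using picard_limit(1)[OF x0\<phi>] by (simp add: y_def truncated_solution_def[abs_def])
    show cont: "continuous_on {0..T} (y n)"
      by (rule continuous_on_subset[OF cont']) auto
    have eq: "y n t = x0 + integral {0..t} ?\<rho> + \<phi> t" if "t \<in> {0..T}" for t
      using picard_limit(2)[OF x0\<phi>, of t] that by (simp add: y_def truncated_solution_def[abs_def])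
    have int: "?\<rho> integrable_on {0..T}"
      by (intro integrable_continuous_real continuous_on_drift cont) auto
    have pos: "\<delta> < y n t" if t: "t \<in> {0..T}" for t
    proof (rule lower_bound[OF cont int eq \<phi>(2) hoelder _ _ t])
      show "0 \<le> ?\<rho> s" if "s \<in> {0..T}" for s
        using f that by (auto simp: truncated_drift_def assumption_i_def less_max_iff_disj)
      show "g s * y n s powr - \<alpha> \<le> ?\<rho> s" if "s \<in> {0..T}" "\<delta> \<le> y n s" "y n s < x1" for s
      proof -
        have "max (1 / real (Suc n)) (min (y n s) (real (Suc n))) = y n s"
          using that n_small n_large by auto
        then show ?thesis using lower[of s "y n s"] that \<delta> by (simp add: truncated_drift_def)
      qed
    qed
    have bound: "y n t \<le> U" if t: "t \<in> {0..T}" for t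
      unfolding U_def
    proof (rule solution_upper_bound[OF cont int eq \<phi>(2) _ _ K(1) t])
      show "?\<rho> s \<le> K" if "s \<in> {0..T}" "x0 \<le> y n s" for s
        unfolding truncated_drift_def
        by (rule K(2)[OF that(1)]) (use that n_large n_small in auto)
      show "\<phi> t - \<phi> s \<le> C * T powr \<beta>" if "t \<in> {0..T}" "s \<in> {0..T}" for s t
        by (rule hoelder_oscillation[OF hoelder]) (use C that in auto)
    qed
    have same: "?\<rho> s = f s (y n s)" if "s \<in> {0..T}" for s
    proof -
      have "max (1 / real (Suc n)) (min (y n s) (real (Suc n))) = y n s"
        using pos[OF that] bound[OF that] n_small n_large by auto
      then show ?thesis by (simp add: truncated_drift_def)
    qed
    show "0 < y n t" if "t \<in> {0..T}" for t using pos[OF that] \<delta> by simp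
    show "(\<lambda>s. f s (y n s)) integrable_on {0..T}"
      by (rule integrable_eq[OF int]) (use same in auto)
    show "y n t = x0 + integral {0..t} (\<lambda>s. f s (y n s)) + \<phi> t" if t: "t \<in> {0..T}" for t
    proof -
      have "integral {0..t} ?\<rho> = integral {0..t} (\<lambda>s. f s (y n s))"
        by (rule Henstock_Kurzweil_Integration.integral_cong) (use same t in auto)
      then show ?thesis using eq[OF t] by simp
    qed
  qed
  show ?thesis
  proof (rule that[of N])
    fix n t assume n: "N \<le> n" and t: "t \<in> {0..T}"
    note sol_n = sol[OF n] and sol_N = sol[OF order_refl]
    show "y n t = y N t"
    proof (rule monotone_drift_unique[where S = "{0<..}" and G = f and T = T and u = "y n" and v = "y N"
          and c = x0 and \<phi> = \<phi>])
      show "f s y \<le> f s x" if "0 < s" "x \<in> {0<..}" "y \<in> {0<..}" "x \<le> y" for s x y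
        using assumption_i_antimono[OF f] that by auto
      show "y n t \<in> {0<..}" "y N t \<in> {0<..}" if "t \<in> {0..T}" for t
        using sol_n(2)[OF that] sol_N(2)[OF that] by auto
    qed (fact sol_n sol_N t)+
  qed (use sol[OF order_refl] in auto)
qed

text \<open>On each compact time interval the sequence is eventually constant in \<open>n\<close>,
  so the limit inherits all properties of a single truncated solution there. The threshold may
  depend on the interval and on the path.\<close>

lemma limit_solution:
  fixes \<phi> :: "real \<Rightarrow> real"
  assumes \<phi>: "continuous_on {0..} \<phi>" "\<phi> 0 = 0"
    and hoelder: "\<And>T. 0 < T \<Longrightarrow>
      \<exists>C>0. \<forall>s\<in>{0..T}. \<forall>t\<in>{0..T}. \<bar>\<phi> t - \<phi> s\<bar> \<le> C * \<bar>t - s\<bar> powr \<beta>"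
  defines "x \<equiv> \<lambda>t. lim (\<lambda>n. truncated_solution f x0 \<phi> n t)"
  shows "continuous_on {0..} x"
    and "0 \<le> t \<Longrightarrow> 0 < x t"
    and "0 \<le> t \<Longrightarrow> (\<lambda>s. f s (x s)) integrable_on {0..t} \<and> x t = x0 + integral {0..t} (\<lambda>s. f s (x s)) + \<phi> t"
proof -
  have local: "continuous_on {0..T} x \<and>
      (\<forall>t\<in>{0..T}. 0 < x t \<and> x t = x0 + integral {0..t} (\<lambda>s. f s (x s)) + \<phi> t)" if T: "0 < T" for T
  proof -
    obtain C where C: "0 < C" "\<And>s t. s \<in> {0..T} \<Longrightarrow> t \<in> {0..T} \<Longrightarrow> \<bar>\<phi> t - \<phi> s\<bar> \<le> C * \<bar>t - s\<bar> powr \<beta>"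
      using hoelder[OF T] by blast
    obtain N where N:
      "\<And>t. t \<in> {0..T} \<Longrightarrow> 0 < truncated_solution f x0 \<phi> N t \<and> truncated_solution f x0 \<phi> N t =
          x0 + integral {0..t} (\<lambda>s. f s (truncated_solution f x0 \<phi> N s)) + \<phi> t"
      "continuous_on {0..T} (truncated_solution f x0 \<phi> N)"
      "\<And>n t. N \<le> n \<Longrightarrow> t \<in> {0..T} \<Longrightarrow> truncated_solution f x0 \<phi> n t = truncated_solution f x0 \<phi> N t"
      using truncated_solution_eventually_solves[OF \<phi> C(1) T C(2)] by blast
    have x: "x t = truncated_solution f x0 \<phi> N t" if "t \<in> {0..T}" for t
      unfolding x_def
      by (rule limI, rule tendsto_eventually, rule eventually_sequentiallyI[of N])
        (rule N(3)[OF _ that])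
    have "continuous_on {0..T} x"
      by (rule continuous_on_eq[OF N(2)]) (simp add: x)
    moreover have "x t = x0 + integral {0..t} (\<lambda>s. f s (x s)) + \<phi> t" if t: "t \<in> {0..T}" for t
    proof -
      have "integral {0..t} (\<lambda>s. f s (truncated_solution f x0 \<phi> N s)) = integral {0..t} (\<lambda>s. f s (x s))"
        by (rule Henstock_Kurzweil_Integration.integral_cong) (use x t in auto)
      then show ?thesis using N(1)[OF t] x[OF t] by simp
    qed
    moreover have "0 < x t" if "t \<in> {0..T}" for t using N(1)[OF that] x[OF that] by simp
    ultimately show ?thesis by blast
  qed
  show cont: "continuous_on {0..} x"
  proof (rule continuous_on_atLeast)
    fix T :: real
    show "continuous_on {0..T} x"
      \<comment> \<open>\<open>local\<close> asks for a positive horizon, while \<open>T\<close> is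
        arbitrary here.\<close>
      by (rule continuous_on_subset[of "{0..max 1 T}"]) (use local[of "max 1 T"] in auto)
  qed
  show pos: "0 < x t" if "0 \<le> t" for t
    using local[of "t + 1"] that by fastforce
  show "(\<lambda>s. f s (x s)) integrable_on {0..t} \<and> x t = x0 + integral {0..t} (\<lambda>s. f s (x s)) + \<phi> t"
    if "0 \<le> t"
  proof
    show "(\<lambda>s. f s (x s)) integrable_on {0..t}"
      by (intro integrable_continuous_real assumption_i_continuous_along[OF f]
          continuous_on_subset[OF cont] pos) auto
    show "x t = x0 + integral {0..t} (\<lambda>s. f s (x s)) + \<phi> t"
      using local[of "t + 1"] that by auto
  qed
qed

lemma truncated_solution_measurable:
  assumes B: "\<And>t. 0 \<le> t \<Longrightarrow> B t \<in> borel_measurable M"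
    and cont: "\<And>\<omega>. \<omega> \<in> space M \<Longrightarrow> continuous_on {0..} (\<lambda>t. B t \<omega>)"
    and t: "0 \<le> t"
  shows "(\<lambda>\<omega>. truncated_solution f x0 (\<lambda>t. B t \<omega>) n t) \<in> borel_measurable M"
proof -
  interpret lipschitz_drift "truncated_drift f n"
    by (rule truncated_lipschitz_drift[OF f])
  show ?thesis
    unfolding truncated_solution_def
    by (intro borel_measurable_lim_metric picard_measurable[where \<phi> = "\<lambda>t \<omega>. x0 + B t \<omega>"])
      (use B t in \<open>auto intro!: continuous_intros cont\<close>)
qed

end

section \<open>The random solution: measurability, uniqueness and moments\<close>

theorem theorem3p1:
  fixes M :: "'w measure"
    and H x0 :: real
    and B :: "real \<Rightarrow> 'w \<Rightarrow> real"
    and f :: "real \<Rightarrow> real \<Rightarrow> real"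
  assumes "prob_space M" and "complete_measure M"
    and "1 / 2 < H" and "H < 1"
    and "fractional_brownian_motion M H B"
    and "0 < x0"
    and "assumption_i f" and "assumption_ii H f" and "assumption_iii f"
  shows "\<exists>X. pathwise_solution M f x0 B X \<and> positive_paths M X \<and>
    (\<forall>Y. pathwise_solution M f x0 B Y \<and> positive_paths M Y \<longrightarrow>
       (AE \<omega> in M. \<forall>t\<ge>0. Y t \<omega> = X t \<omega>)) \<and>
    (\<forall>T>0. \<forall>p>0. in_Lp M p (\<lambda>\<omega>. sup_norm T (\<lambda>t. X t \<omega>)))"
proof -
  interpret prob_space M by fact
  note fbm = \<open>fractional_brownian_motion M H B\<close>
  obtain x1 \<alpha> g where ii: "0 < x1" "1 / H - 1 < \<alpha>" "continuous_on {0..} g"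
      "\<And>t. 0 < t \<Longrightarrow> 0 < g t"
      "\<And>t x. 0 \<le> t \<Longrightarrow> 0 < x \<Longrightarrow> x < x1 \<Longrightarrow> g t * x powr (- \<alpha>) \<le> f t x"
    using \<open>assumption_ii H f\<close> unfolding assumption_ii_def by auto
  obtain h where h: "(\<forall>t\<ge>0. 0 \<le> h t) \<and> (\<forall>T\<ge>0. bounded (h ` {0..T})) \<and>
      (\<forall>t\<ge>0. \<forall>x>0. f t x \<le> h t * (1 + 1 / x))"
    using \<open>assumption_iii f\<close> unfolding assumption_iii_def by (rule exE)
  have iii: "\<And>t. 0 \<le> t \<Longrightarrow> 0 \<le> h t" "\<And>T. 0 \<le> T \<Longrightarrow> bounded (h ` {0..T})"
      "\<And>t x. 0 \<le> t \<Longrightarrow> 0 < x \<Longrightarrow> f t x \<le> h t * (1 + 1 / x)"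
    using h by simp_all
  \<comment> \<open>The strict inequality \<open>1 / H - 1 < \<alpha>\<close> leaves room for an
    exponent \<open>\<beta>\<close> that is below \<open>H\<close>, for path regularity, and above
    \<open>1 / (\<alpha> + 1)\<close>, for the lower bound.\<close>
  have \<alpha>: "0 < \<alpha>" "1 / (\<alpha> + 1) < H"
  proof -
    have "0 < 1 / H - 1" using \<open>1 / 2 < H\<close> \<open>H < 1\<close> by simp
    with ii(2) show "0 < \<alpha>" by simp
    with ii(2) show "1 / (\<alpha> + 1) < H" using \<open>1 / 2 < H\<close> by (simp add: field_simps)
  qed
  then obtain \<beta> where \<beta>H: "1 / (\<alpha> + 1) < \<beta>" "\<beta> < H" using dense by blast
  have \<beta>0: "0 < \<beta>" "1 < \<beta> * (\<alpha> + 1)"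
  proof -
    have "0 < 1 / (\<alpha> + 1)" using \<alpha> by simp
    with \<beta>H show "0 < \<beta>" by linarith
    show "1 < \<beta> * (\<alpha> + 1)" using \<alpha> \<beta>H by (simp add: field_simps)
  qed
  interpret singular_drift f x0 x1 \<alpha> \<beta> g h
    by unfold_locales (fact \<open>assumption_i f\<close> \<open>0 < x0\<close> ii \<alpha> \<beta>0 iii)+
  have B_cont: "continuous_on {0..} (\<lambda>t. B t \<omega>)" if "\<omega> \<in> space M" for \<omega>
    using fbm that by (simp add: fractional_brownian_motion_def continuous_paths_def)
  define hoelder where "hoelder C T \<omega> \<longleftrightarrow>
    (\<forall>s\<in>{0..T}. \<forall>t\<in>{0..T}. \<bar>B t \<omega> - B s \<omega>\<bar> \<le> C * \<bar>t - s\<bar> powr \<beta>)" for C T \<omega>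
  have hoelder_moment: "\<exists>K. K \<in> borel_measurable M \<and> (\<forall>\<omega>. 0 \<le> K \<omega>) \<and>
      integrable M (\<lambda>\<omega>. K \<omega> ^ (2 * k)) \<and> (AE \<omega> in M. hoelder (K \<omega>) T \<omega>)"
    if Tk: "0 < T" "1 < 2 * real k * (H - \<beta>)" for T k
  proof -
    obtain K where "K \<in> borel_measurable M" "\<And>\<omega>. 0 \<le> K \<omega>" "integrable M (\<lambda>\<omega>. K \<omega> ^ (2 * k))"
      "AE \<omega> in M. \<forall>s\<in>{0..T}. \<forall>t\<in>{0..T}. \<bar>B t \<omega> - B s \<omega>\<bar> \<le> K \<omega> * \<bar>t - s\<bar> powr \<beta>"
      using fbm_hoelder[OF fbm \<beta>0(1) Tk] by blast
    then show ?thesis unfolding hoelder_def by (intro exI[of _ K] conjI allI)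
  qed
  \<comment> \<open>One \<open>k\<close> serves two purposes: the Hoelder constant exists with a
    finite moment of order \<open>2 * k\<close>, and this order dominates \<open>p\<close>.\<close>
  have large_k: "\<exists>k. 1 < 2 * real k * (H - \<beta>) \<and> p \<le> 2 * real k" for p
  proof -
    obtain k where "max (1 / (2 * (H - \<beta>))) p < real k" using reals_Archimedean2 by blast
    then have "1 / (2 * (H - \<beta>)) < real k" "p < real k" by auto
    then have "1 < real k * (2 * (H - \<beta>))" "p \<le> 2 * real k"
      using \<beta>H by (simp_all add: pos_divide_less_eq)
    then have "1 < 2 * real k * (H - \<beta>) \<and> p \<le> 2 * real k" by (simp add: mult_ac)
    then show ?thesis by blast
  qed
  \<comment> \<open>Integer horizons keep the union of null sets countable; smaller horizons inherit
    the constant.\<close>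
  have "AE \<omega> in M. B 0 \<omega> = 0 \<and> (\<forall>n. \<exists>C>0. hoelder C (real (Suc n)) \<omega>)"
    unfolding AE_conj_iff AE_all_countable
  proof (intro conjI allI)
    show "AE \<omega> in M. B 0 \<omega> = 0" by (rule fbm_AE_zero[OF fbm])
    fix n
    obtain k where k: "1 < 2 * real k * (H - \<beta>)" using large_k by blast
    obtain K where K: "\<And>\<omega>. 0 \<le> K \<omega>" "AE \<omega> in M. hoelder (K \<omega>) (real (Suc n)) \<omega>"
      using hoelder_moment[of "real (Suc n)" k] k by auto
    from K(2) show "AE \<omega> in M. \<exists>C>0. hoelder C (real (Suc n)) \<omega>"
    proof eventually_elim
      case (elim \<omega>)
      \<comment> \<open>\<open>K\<close> may vanish, and the pathwise lemmas need a positive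
        constant.\<close>
      have "hoelder (K \<omega> + 1) (real (Suc n)) \<omega>"
        using elim unfolding hoelder_def by (fastforce simp: distrib_right intro: add_increasing2)
      moreover have "0 < K \<omega> + 1" using K(1)[of \<omega>] by simp
      ultimately show ?case by blast
    qed
  qed
  then have "AE \<omega> in M. B 0 \<omega> = 0 \<and> (\<forall>T>0. \<exists>C>0. hoelder C T \<omega>)"
  proof (rule eventually_mono, intro conjI allI impI)
    fix \<omega> and T :: real assume *: "B 0 \<omega> = 0 \<and> (\<forall>n. \<exists>C>0. hoelder C (real (Suc n)) \<omega>)"
    show "B 0 \<omega> = 0" using * by simp
    obtain n where n: "T < real n" using reals_Archimedean2 by blast
    obtain C where C: "0 < C" "hoelder C (real (Suc n)) \<omega>" using * by blast
    have "hoelder C T \<omega>"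
      using C(2) n unfolding hoelder_def by auto
    with C show "\<exists>C>0. hoelder C T \<omega>" by blast
  qed
  \<comment> \<open>The exceptional outcomes are enclosed in a measurable null set, so that a case
    distinction on it is measurable.\<close>
  from AE_E[OF this] obtain N where
    bad: "{\<omega> \<in> space M. \<not> (B 0 \<omega> = 0 \<and> (\<forall>T>0. \<exists>C>0. hoelder C T \<omega>))} \<subseteq> N"
      "emeasure M N = 0" "N \<in> sets M" by blast
  have AE_N: "AE \<omega> in M. \<omega> \<in> space M - N"
    by (rule AE_I[of _ _ N]) (use bad in auto)
  have good: "B 0 \<omega> = 0" "\<And>T. 0 < T \<Longrightarrow> \<exists>C>0. hoelder C T \<omega>" if "\<omega> \<in> space M - N" for \<omega>
    using that bad(1) by auto
  \<comment> \<open>Continuity is demanded of every path, so the null set has to be cut out explicitly.\<close>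
  define X where "X t \<omega> =
    (if \<omega> \<in> N then x0 else lim (\<lambda>n. truncated_solution f x0 (\<lambda>t. B t \<omega>) n t))" for t \<omega>
  have X: "continuous_on {0..} (\<lambda>t. X t \<omega>)" "\<And>t. 0 \<le> t \<Longrightarrow> 0 < X t \<omega>"
    "\<And>t. 0 \<le> t \<Longrightarrow> (\<lambda>s. f s (X s \<omega>)) integrable_on {0..t} \<and>
        X t \<omega> = x0 + integral {0..t} (\<lambda>s. f s (X s \<omega>)) + B t \<omega>"
    if \<omega>: "\<omega> \<in> space M - N" for \<omega>
  proof -
    have Xeq: "X t \<omega> = lim (\<lambda>n. truncated_solution f x0 (\<lambda>t. B t \<omega>) n t)" for t
      using \<omega> by (simp add: X_def)
    have \<phi>: "continuous_on {0..} (\<lambda>t. B t \<omega>)" using B_cont \<omega> by simp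
    note sol = limit_solution[OF \<phi> good(1)[OF \<omega>] good(2)[OF \<omega>, unfolded hoelder_def]]
    show "continuous_on {0..} (\<lambda>t. X t \<omega>)" and "\<And>t. 0 \<le> t \<Longrightarrow> 0 < X t \<omega>"
      and "\<And>t. 0 \<le> t \<Longrightarrow> (\<lambda>s. f s (X s \<omega>)) integrable_on {0..t} \<and>
        X t \<omega> = x0 + integral {0..t} (\<lambda>s. f s (X s \<omega>)) + B t \<omega>"
      using sol by (simp_all only: Xeq)
  qed
  have X_cont: "continuous_on {0..} (\<lambda>t. X t \<omega>)" if "\<omega> \<in> space M" for \<omega>
    using X(1)[of \<omega>] that by (cases "\<omega> \<in> N") (auto simp: X_def)
  \<comment> \<open>A pointwise \<open>lim\<close> of measurable functions is measurable even at
    outcomes in \<open>N\<close>, where the truncated solutions need not converge.\<close>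
  have X_meas: "X t \<in> borel_measurable M" if "0 \<le> t" for t
    unfolding X_def
    by (intro measurable_If_set borel_measurable_lim_metric truncated_solution_measurable
        fbm_measurable[OF fbm] B_cont that) (use bad(3) in auto)
  have sol: "pathwise_solution M f x0 B X"
    unfolding pathwise_solution_def continuous_paths_def
  proof (intro conjI allI impI ballI X_meas X_cont)
    show "AE \<omega> in M. \<forall>t\<ge>0. (\<lambda>s. f s (X s \<omega>)) integrable_on {0..t} \<and>
        X t \<omega> = x0 + integral {0..t} (\<lambda>s. f s (X s \<omega>)) + B t \<omega>"
      using AE_N by (rule eventually_mono) (use X(3) in blast)
  qed
  have pos: "positive_paths M X"
    unfolding positive_paths_def using AE_N by (rule eventually_mono) (use X(2) in blast)
  have unique: "AE \<omega> in M. \<forall>t\<ge>0. Y t \<omega> = X t \<omega>"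
    if Y: "pathwise_solution M f x0 B Y" "positive_paths M Y" for Y
  proof -
    have "AE \<omega> in M. \<forall>t\<ge>0. (\<lambda>s. f s (Y s \<omega>)) integrable_on {0..t} \<and>
        Y t \<omega> = x0 + integral {0..t} (\<lambda>s. f s (Y s \<omega>)) + B t \<omega>"
      using Y(1) by (simp add: pathwise_solution_def)
    moreover have "AE \<omega> in M. \<forall>t\<ge>0. 0 < Y t \<omega>"
      using Y(2) by (simp add: positive_paths_def)
    ultimately show ?thesis using AE_N
    proof eventually_elim
      case (elim \<omega>)
      have "continuous_on {0..} (\<lambda>t. Y t \<omega>)"
        using Y(1) elim(3) by (simp add: pathwise_solution_def continuous_paths_def)
      note Y_cont = this
      show ?case
      proof (intro allI impI)
        fix t :: real assume "0 \<le> t"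
        show "Y t \<omega> = X t \<omega>"
          by (rule positive_solution_unique[where u = "\<lambda>t. Y t \<omega>" and v = "\<lambda>t. X t \<omega>"
                and \<phi> = "\<lambda>t. B t \<omega>" and c = x0])
            (fact \<open>assumption_i f\<close> elim(1)[rule_format] Y_cont elim(2)[rule_format]
              X[OF elim(3)] \<open>0 \<le> t\<close>)+
      qed
    qed
  qed
  have "in_Lp M p (\<lambda>\<omega>. sup_norm T (\<lambda>t. X t \<omega>))" if T: "0 < T" and p: "0 < p" for T p
  proof -
    have meas [measurable]: "(\<lambda>\<omega>. sup_norm T (\<lambda>t. X t \<omega>)) \<in> borel_measurable M"
      by (rule sup_norm_measurable)
        (use T X_meas in \<open>auto intro: continuous_on_subset[OF X_cont]\<close>)
    obtain k where k: "1 < 2 * real k * (H - \<beta>)" "p \<le> 2 * real k" using large_k by blast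
    obtain K where [measurable]: "K \<in> borel_measurable M" and K: "\<And>\<omega>. 0 \<le> K \<omega>"
        "integrable M (\<lambda>\<omega>. K \<omega> ^ (2 * k))" "AE \<omega> in M. hoelder (K \<omega>) T \<omega>"
      using hoelder_moment[OF T k(1)] by blast
    obtain c where c: "0 \<le> c" "\<And>t x. t \<in> {0..T} \<Longrightarrow> x0 \<le> x \<Longrightarrow> f t x \<le> c"
      using drift_bound_above[of T] T by auto
    define a where "a = x0 + c * T"
    have a: "0 \<le> a" using \<open>0 < x0\<close> c T by (simp add: a_def)
    \<comment> \<open>Positivity turns the one-sided bound on \<open>X\<close> into a bound on its
      absolute value, linear in the random Hoelder constant.\<close>
    have bound: "AE \<omega> in M. 0 \<le> sup_norm T (\<lambda>t. X t \<omega>) \<and> sup_norm T (\<lambda>t. X t \<omega>) \<le> a + T powr \<beta> * K \<omega>"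
      using K(3) AE_N
    proof eventually_elim
      case (elim \<omega>)
      note X\<omega> = X[OF elim(2)]
      have "X t \<omega> \<le> x0 + c * T + K \<omega> * T powr \<beta>" if t: "t \<in> {0..T}" for t
      proof (rule solution_upper_bound[where \<phi> = "\<lambda>t. B t \<omega>" and \<rho> = "\<lambda>s. f s (X s \<omega>)", OF _ _ _ _ _ _ c(1) t])
        show "continuous_on {0..T} (\<lambda>t. X t \<omega>)" by (rule continuous_on_subset[OF X\<omega>(1)]) auto
        show "B t \<omega> - B s \<omega> \<le> K \<omega> * T powr \<beta>" if "t \<in> {0..T}" "s \<in> {0..T}" for s t
          by (rule hoelder_oscillation[where \<phi> = "\<lambda>t. B t \<omega>"])
            (use elim(1) K(1) that in \<open>auto simp: hoelder_def\<close>)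
      qed (use X\<omega> good(1)[OF elim(2)] c T in auto)
      then have abs: "\<bar>X t \<omega>\<bar> \<le> a + T powr \<beta> * K \<omega>" if "t \<in> {0..T}" for t
        using X\<omega>(2)[of t] that by (auto simp: a_def mult.commute)
      have "\<bar>X 0 \<omega>\<bar> \<le> sup_norm T (\<lambda>t. X t \<omega>)"
        unfolding sup_norm_def
        by (rule cSUP_upper) (use T abs in \<open>auto intro!: bdd_aboveI2[where M = "a + T powr \<beta> * K \<omega>"]\<close>)
      moreover have "sup_norm T (\<lambda>t. X t \<omega>) \<le> a + T powr \<beta> * K \<omega>"
        unfolding sup_norm_def by (rule cSUP_least) (use T abs in auto)
      ultimately show ?case by auto
    qed
    \<comment> \<open>The real power \<open>p\<close> is dominated by 1 plus the power
      \<open>2 * k\<close>, and \<open>a + b \<le> 2 * max a b\<close> separates the deterministic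
      part from \<open>K\<close>, whose moment of order \<open>2 * k\<close> is finite.\<close>
    have "integrable M (\<lambda>\<omega>. \<bar>sup_norm T (\<lambda>t. X t \<omega>)\<bar> powr p)"
    proof (rule Bochner_Integration.integrable_bound)
      show "integrable M (\<lambda>\<omega>. 1 + 2 ^ (2 * k) * (a ^ (2 * k) + (T powr \<beta>) ^ (2 * k) * K \<omega> ^ (2 * k)))"
        using K(2) by auto
      show "AE \<omega> in M. norm (\<bar>sup_norm T (\<lambda>t. X t \<omega>)\<bar> powr p)
          \<le> norm (1 + 2 ^ (2 * k) * (a ^ (2 * k) + (T powr \<beta>) ^ (2 * k) * K \<omega> ^ (2 * k)))"
        using bound
      proof eventually_elim
        case (elim \<omega>)
        define S where "S = sup_norm T (\<lambda>t. X t \<omega>)"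
        define b where "b = T powr \<beta> * K \<omega>"
        have b: "0 \<le> b" using K(1) by (simp add: b_def)
        have S: "0 \<le> S" "S \<le> a + b" using elim by (auto simp: S_def b_def)
        have "S powr p \<le> 1 + S ^ (2 * k)"
        proof (cases "S \<le> 1")
          case True
          then have "S powr p \<le> 1" using S p by (intro powr_le1) auto
          then show ?thesis using S by (intro add_increasing2) auto
        next
          case False
          then have "S powr p \<le> S powr real (2 * k)" using k by (intro powr_mono) auto
          also have "\<dots> = S ^ (2 * k)" using False by (intro powr_realpow) auto
          finally show ?thesis by simp
        qed
        also have "S ^ (2 * k) \<le> (2 * max a b) ^ (2 * k)" using S by (intro power_mono) auto
        also have "\<dots> = 2 ^ (2 * k) * max a b ^ (2 * k)" by (rule power_mult_distrib)
        also have "max a b ^ (2 * k) \<le> a ^ (2 * k) + b ^ (2 * k)"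
          using a b by (auto simp: max_def)
        finally have "S powr p \<le> 1 + 2 ^ (2 * k) * (a ^ (2 * k) + b ^ (2 * k))" by simp
        then show ?case
          using S(1) by (simp add: S_def[symmetric] b_def power_mult_distrib)
      qed
    qed measurable
    then show ?thesis by (simp add: in_Lp_def)
  qed
  with sol pos unique show ?thesis by blast
qed

end
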